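(* Let $N\ge 2$, $s_0\in(0,1)$ and let $\Omega\subset\mathbb{R}^N$ be a bounded domain. For each $s\in(0,s_0]$ let $u_s\in L^\infty(\mathbb{R}^N)$ be $s$-harmonic in $\Omega$, and assume there is a constant $C>0$ with $\|u_s\|_{L^\infty(\mathbb{R}^N)}\le C$ for all $s\in(0,s_0]$. Then $$\inf_{c\in\mathbb{R}}|u_s-c|\to 0\qquad\text{as } s\to0^+,\ \text{locally uniformly in }\Omega,$$ i.e. for every compact $K\subset\Omega$, $\inf_{c\in\mathbb{R}}\sup_{x\in K}|u_s(x)-c|\to0$ as $s\to0^+$.
   Context: For $s\in(0,1)$ let $c_{N,s}=\frac{4^s\Gamma(\frac N2+s)}{\Gamma(2-s)\pi^{N/2}}\,s(1-s)$ and define the fractional Laplacian $(-\Delta)^s u(x)=c_{N,s}\lim_{\epsilon\to0}\int_{\{|x-y|>\epsilon\}}\frac{u(x)-u(y)}{|x-y|^{N+2s}}\,dy$. For $s\ge0$, $L^1_s(\mathbb{R}^N)$ denotes the space of $u\in L^1_{loc}(\mathbb{R}^N)$ with $\int_{\mathbb{R}^N}|u(x)|(1+|x|)^{-N-2s}dx<\infty$. A function $u\in L^1_s(\mathbb{R}^N)$ is called $s$-harmonic in an open set $D$ if $\int_{\mathbb{R}^N}u\,(-\Delta)^s\phi\,dx=0$ for all $\phi\in C_c^\infty(D)$; such $u$ coincides a.e. in $D$ with a $C^\infty(D)$ function satisfying $(-\Delta)^su=0$ pointwise in $D$, and this representative is used. *)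

theory Defs
  imports "HOL-Analysis.Analysis"
begin

definition frac_const :: "nat \<Rightarrow> real \<Rightarrow> real" where
  "frac_const N s = 4 powr s * Gamma (real N / 2 + s) / (Gamma (2 - s) * pi powr (real N / 2)) * s * (1 - s)"

definition partial_dir :: "'a::euclidean_space \<Rightarrow> ('a \<Rightarrow> real) \<Rightarrow> 'a \<Rightarrow> real" where
  "partial_dir i f x = deriv (\<lambda>t. f (x + t *\<^sub>R i)) 0"

fun iter_partial :: "'a::euclidean_space list \<Rightarrow> ('a \<Rightarrow> real) \<Rightarrow> 'a \<Rightarrow> real" where
  "iter_partial [] f = f"
| "iter_partial (i # is) f = partial_dir i (iter_partial is f)"

definition smooth_fun :: "('a::euclidean_space \<Rightarrow> real) \<Rightarrow> bool" where
  "smooth_fun f \<longleftrightarrow> (\<forall>is. set is \<subseteq> Basis \<longrightarrow>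
      continuous_on UNIV (iter_partial is f) \<and>
      (\<forall>i\<in>Basis. \<forall>x. (\<lambda>t. iter_partial is f (x + t *\<^sub>R i)) differentiable (at 0)))"

definition test_fun :: "'a::euclidean_space set \<Rightarrow> ('a \<Rightarrow> real) \<Rightarrow> bool" where
  "test_fun D \<phi> \<longleftrightarrow> smooth_fun \<phi> \<and> compact (closure {x. \<phi> x \<noteq> 0}) \<and> closure {x. \<phi> x \<noteq> 0} \<subseteq> D"

definition frac_lap :: "real \<Rightarrow> ('a::euclidean_space \<Rightarrow> real) \<Rightarrow> 'a \<Rightarrow> real" where
  "frac_lap s u x = frac_const DIM('a) s *
     Lim (at_right 0) (\<lambda>\<epsilon>. integral\<^sup>L lebesgue
        (\<lambda>y. indicator {y. \<epsilon> < dist x y} y * ((u x - u y) / dist x y powr (real DIM('a) + 2 * s))))"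

definition L1s :: "real \<Rightarrow> ('a::euclidean_space \<Rightarrow> real) \<Rightarrow> bool" where
  "L1s s u \<longleftrightarrow> u \<in> borel_measurable lebesgue \<and>
     (\<forall>K. compact K \<longrightarrow> set_integrable lebesgue K u) \<and>
     integrable lebesgue (\<lambda>x. \<bar>u x\<bar> * (1 + norm x) powr (- (real DIM('a) + 2 * s)))"

definition s_harmonic :: "real \<Rightarrow> ('a::euclidean_space \<Rightarrow> real) \<Rightarrow> 'a set \<Rightarrow> bool" where
  "s_harmonic s u D \<longleftrightarrow> L1s s u \<and>
     (\<forall>\<phi>. test_fun D \<phi> \<longrightarrow> integral\<^sup>L lebesgue (\<lambda>x. u x * frac_lap s \<phi> x) = 0)"

end

theory Submission
  imports Defs
begin

text \<open>
  A maximum principle argument shows that the oscillation of \<open>u s\<close> over \<open>K\<close> is \<open>O(s)\<close>. Write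
  \<open>k z = norm z powr - (N + 2 * s)\<close>; its mass \<open>M\<close> over \<open>norm z \<ge> 1\<close> is of order \<open>1 / s\<close>,
  while \<open>norm z * k z\<close> has bounded mass over \<open>norm z \<le> 1\<close> for \<open>s \<le> 1 / 4\<close>. Let \<open>w\<close> be a regular
  \<open>s\<close>-harmonic function bounded by \<open>C\<close>. Subtracting a cone with vertex \<open>x0\<close> from \<open>w\<close>
  gives a function with a global maximum at some \<open>x1\<close> near \<open>x0\<close>. Evaluating the equation at \<open>x1\<close> yields
  \<open>M * w x0 \<le> T x1 + O(1)\<close>, where \<open>T x\<close> is the integral of \<open>w (x + z) * k z\<close> over \<open>norm z \<ge> 1\<close>,
  and likewise \<open>M * w y0 \<ge> T y1 - O(1)\<close>. As \<open>T x1 - T y1\<close> is bounded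
  uniformly in \<open>s\<close>, dividing by \<open>M\<close> gives \<open>w x0 - w y0 = O(s)\<close>. The bound does not involve the
  regularity of \<open>w\<close>, so it passes from the mollifications of \<open>u s\<close> to \<open>u s\<close> itself. Since only
  \<open>s < 1 / 2\<close> matters, the fractional Laplacian of a bounded Lipschitz function is an absolutely
  convergent integral, and no principal values are needed.
\<close>

section \<open>Smooth bump functions\<close>

text \<open>The functions p(1/t) exp(-1/t), extended by zero to t <= 0, form a family closed under
  differentiation, so a single first-derivative computation yields smoothness of every order, also
  at t = 0.\<close>

definition exp_flat :: "real poly \<Rightarrow> real \<Rightarrow> real" where
  "exp_flat p t = (if t > 0 then poly p (1 / t) * exp (- (1 / t)) else 0)"

lemma poly_times_exp_minus_tendsto_0:
  fixes p :: "real poly"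
  shows "((\<lambda>x. poly p x * exp (- x)) \<longlongrightarrow> 0) at_top"
proof -
  have "((\<lambda>x. \<Sum>i\<le>degree p. coeff p i * (x ^ i / exp x)) \<longlongrightarrow> (\<Sum>i\<le>degree p. coeff p i * 0)) at_top"
    by (intro tendsto_intros tendsto_power_div_exp_0)
  then show ?thesis
    by (simp add: poly_altdef exp_minus sum_divide_distrib divide_inverse sum_distrib_right mult.assoc)
qed

text \<open>With x = 1/t and dx/dt = -x^2, the derivative of p(x) exp(-x) is x^2 (p(x) - p'(x))
  exp(-x); the factor x^2 is \<open>[:0, 0, 1:]\<close>.\<close>

lemma has_real_derivative_exp_flat:
  "(exp_flat p has_real_derivative exp_flat ([:0, 0, 1:] * (p - pderiv p)) t) (at t)"
proof (cases t "0::real" rule: linorder_cases)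
  case less
  have "((\<lambda>x. 0) has_real_derivative 0) (at t)" by simp
  then have "(exp_flat p has_real_derivative 0) (at t)"
    by (rule has_field_derivative_transform_within_open[where S = "{..<0}"])
      (use less in \<open>auto simp: exp_flat_def\<close>)
  then show ?thesis using less by (simp add: exp_flat_def)
next
  case greater
  have "((\<lambda>t. poly p (1 / t) * exp (- (1 / t))) has_real_derivative
      exp_flat ([:0, 0, 1:] * (p - pderiv p)) t) (at t)"
    using greater
    by (auto intro!: derivative_eq_intros poly_DERIV[THEN DERIV_chain2]
        simp: exp_flat_def field_simps power2_eq_square)
  then show ?thesis
    by (rule has_field_derivative_transform_within_open[where S = "{0<..}"])
      (use greater in \<open>auto simp: exp_flat_def\<close>)
next
  case equal
  \<comment> \<open>The right difference quotient at 0 is (1/t) p(1/t) exp(-1/t), and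
    \<open>pCons 0 p\<close> is the polynomial x p(x).\<close>
  have "((\<lambda>t. poly (pCons 0 p) (inverse t) * exp (- inverse t)) \<longlongrightarrow> 0) (at_right 0)"
    by (rule filterlim_compose[OF poly_times_exp_minus_tendsto_0 filterlim_inverse_at_top_right])
  then have R: "((\<lambda>t. (exp_flat p t - exp_flat p 0) / (t - 0)) \<longlongrightarrow> 0) (at_right 0)"
    by (rule Lim_transform_eventually)
      (auto simp: eventually_at_filter exp_flat_def field_simps)
  have "((\<lambda>t. 0::real) \<longlongrightarrow> 0) (at_left 0)" by simp
  then have L: "((\<lambda>t. (exp_flat p t - exp_flat p 0) / (t - 0)) \<longlongrightarrow> 0) (at_left 0)"
    by (rule Lim_transform_eventually)
      (auto simp: eventually_at_filter exp_flat_def)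
  have "(exp_flat p has_real_derivative 0) (at 0)"
    unfolding has_field_derivative_iff using L R by (simp add: filterlim_split_at)
  then show ?thesis using equal by (simp add: exp_flat_def)
qed

lemma continuous_on_exp_flat [continuous_intros]:
  "continuous_on S f \<Longrightarrow> continuous_on S (\<lambda>x. exp_flat p (f x))"
  by (rule continuous_on_compose2[where t = UNIV])
    (auto intro: DERIV_continuous_on has_real_derivative_exp_flat)

text \<open>\<open>smooth_fun\<close> quantifies over all iterated partial derivatives. A class
  containing the bumps and closed under one directional derivative settles them by induction on the
  list of directions; sums and products are included because the product rule creates them.\<close>

inductive bump_alg :: "('a::euclidean_space \<Rightarrow> real) \<Rightarrow> bool" where
  const: "bump_alg (\<lambda>x. c)"
| flat: "bump_alg (\<lambda>x. exp_flat p (a + x \<bullet> b))"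
| add: "bump_alg f \<Longrightarrow> bump_alg g \<Longrightarrow> bump_alg (\<lambda>x. f x + g x)"
| mult: "bump_alg f \<Longrightarrow> bump_alg g \<Longrightarrow> bump_alg (\<lambda>x. f x * g x)"

lemma bump_alg_continuous: "bump_alg f \<Longrightarrow> continuous_on S f"
  by (induction rule: bump_alg.induct) (auto intro!: continuous_intros)

lemma bump_alg_partial:
  assumes "bump_alg f"
  shows "\<exists>f'. bump_alg f' \<and> (\<forall>x. ((\<lambda>t. f (x + t *\<^sub>R i)) has_real_derivative f' x) (at 0))"
  using assms
proof (induction rule: bump_alg.induct)
  case (const c)
  show ?case by (intro exI[of _ "\<lambda>x. 0"]) (auto intro: bump_alg.const)
next
  case (flat p a b)
  let ?q = "[:0, 0, 1:] * (p - pderiv p)"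
  have "((\<lambda>t. exp_flat p (a + (x + t *\<^sub>R i) \<bullet> b)) has_real_derivative
      exp_flat ?q (a + x \<bullet> b) * (i \<bullet> b)) (at 0)" for x
  proof -
    have "((\<lambda>t. a + (x + t *\<^sub>R i) \<bullet> b) has_real_derivative (i \<bullet> b)) (at 0)"
      by (auto intro!: derivative_eq_intros simp: inner_add_left)
    from DERIV_chain2[OF _ this, of "exp_flat p" "exp_flat ?q (a + x \<bullet> b)"]
    show ?thesis using has_real_derivative_exp_flat[of p "a + x \<bullet> b"] by simp
  qed
  then show ?case
    by (intro exI[of _ "\<lambda>x. exp_flat ?q (a + x \<bullet> b) * (i \<bullet> b)"])
      (intro conjI allI bump_alg.mult bump_alg.flat bump_alg.const)
next
  case (add f g)
  then obtain f' g' where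
    "bump_alg f'" "\<And>x. ((\<lambda>t. f (x + t *\<^sub>R i)) has_real_derivative f' x) (at 0)"
    "bump_alg g'" "\<And>x. ((\<lambda>t. g (x + t *\<^sub>R i)) has_real_derivative g' x) (at 0)" by blast
  then show ?case
    by (intro exI[of _ "\<lambda>x. f' x + g' x"]) (auto intro!: bump_alg.intros DERIV_add)
next
  case (mult f g)
  then obtain f' g' where
    *: "bump_alg f'" "\<And>x. ((\<lambda>t. f (x + t *\<^sub>R i)) has_real_derivative f' x) (at 0)"
    "bump_alg g'" "\<And>x. ((\<lambda>t. g (x + t *\<^sub>R i)) has_real_derivative g' x) (at 0)" by blast
  have "((\<lambda>t. f (x + t *\<^sub>R i) * g (x + t *\<^sub>R i)) has_real_derivative f' x * g x + g' x * f x) (at 0)" for x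
    using DERIV_mult[OF *(2)[of x] *(4)[of x]] by simp
  then show ?case
    using * mult.hyps
    by (intro exI[of _ "\<lambda>x. f' x * g x + g' x * f x"]) (auto intro!: bump_alg.intros)
qed

lemma bump_alg_partial_dir:
  assumes "bump_alg f"
  shows "bump_alg (partial_dir i f)" "(\<lambda>t. f (x + t *\<^sub>R i)) differentiable (at 0)"
proof -
  obtain f' where f': "bump_alg f'"
    "\<And>x. ((\<lambda>t. f (x + t *\<^sub>R i)) has_real_derivative f' x) (at 0)"
    using bump_alg_partial[OF assms] by blast
  then have "partial_dir i f = f'"
    by (auto simp: partial_dir_def fun_eq_iff intro: DERIV_imp_deriv)
  with f' show "bump_alg (partial_dir i f)" by simp
  show "(\<lambda>t. f (x + t *\<^sub>R i)) differentiable (at 0)"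
    using f'(2) by (auto simp: real_differentiable_def)
qed

lemma bump_alg_smooth:
  assumes "bump_alg f"
  shows "smooth_fun f"
proof -
  have "bump_alg (iter_partial is f)" for "is"
    by (induction "is") (auto simp: assms bump_alg_partial_dir)
  then show ?thesis
    unfolding smooth_fun_def by (auto intro: bump_alg_continuous bump_alg_partial_dir)
qed

lemma bump_alg_prod:
  assumes "finite B" "\<And>b. b \<in> B \<Longrightarrow> bump_alg (f b)"
  shows "bump_alg (\<lambda>x. \<Prod>b\<in>B. f b x)"
  using assms by (induction rule: finite_induct) (auto intro: bump_alg.intros)

section \<open>Lipschitz bumps supported in cubes\<close>

lemma exp_flat_1_bounds: "0 \<le> exp_flat 1 t" "exp_flat 1 t \<le> 1"
  by (auto simp: exp_flat_def)

text \<open>For t > 0 the derivative is x^2 exp(-x) with x = 1/t, which is at most 2 because x^2 / 2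
  <= exp x.\<close>

lemma exp_flat_1_lipschitz: "\<bar>exp_flat 1 s - exp_flat 1 t\<bar> \<le> 2 * \<bar>s - t\<bar>"
proof -
  have b: "norm (exp_flat ([:0, 0, 1:] * (1 - pderiv 1)) t) \<le> 2" for t
  proof (cases "t > 0")
    case True
    have "(1 / t)\<^sup>2 / 2 \<le> exp (1 / t)"
      using exp_lower_Taylor_quadratic[of "1 / t"] zero_less_divide_1_iff[of t] True by linarith
    moreover have "x\<^sup>2 / 2 \<le> exp x \<Longrightarrow> x\<^sup>2 * exp (- x) \<le> 2" for x :: real
      by (simp add: exp_minus field_simps)
    ultimately have "(1 / t)\<^sup>2 * exp (- (1 / t)) \<le> 2"
      by blast
    then show ?thesis using True
      by (simp add: exp_flat_def pderiv_1 power2_eq_square abs_mult)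
  qed (simp add: exp_flat_def)
  have "norm (exp_flat 1 s - exp_flat 1 t) \<le> 2 * norm (s - t)"
    by (rule field_differentiable_bound[where S = UNIV])
      (use b in \<open>auto intro: has_real_derivative_exp_flat[THEN has_field_derivative_at_within]\<close>)
  then show ?thesis by simp
qed

text \<open>Each factor is \<open>exp_flat\<close> of an affine function, which keeps the product
  inside \<open>bump_alg\<close>. The two factors for b are both positive exactly when the
  b-coordinate of x has modulus below d, so the nonzero set is an open cube.\<close>

definition cube_bump :: "real \<Rightarrow> 'a::euclidean_space \<Rightarrow> real" where
  "cube_bump d x = (\<Prod>b\<in>Basis. exp_flat 1 (d - x \<bullet> b) * exp_flat 1 (d + x \<bullet> b))"

lemma cube_bump_bounds: "0 \<le> cube_bump d x" "cube_bump d x \<le> 1"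
  by (auto simp: cube_bump_def intro!: prod_nonneg prod_le_1 mult_le_one exp_flat_1_bounds mult_nonneg_nonneg)

lemma cube_bump_eq_0:
  fixes x :: "'a::euclidean_space" and d :: real
  assumes "norm x \<ge> d * DIM('a)"
  shows "cube_bump d x = 0"
proof (rule ccontr)
  assume "cube_bump d x \<noteq> 0"
  then have "\<And>b. b \<in> Basis \<Longrightarrow> exp_flat 1 (d - x \<bullet> b) \<noteq> 0 \<and> exp_flat 1 (d + x \<bullet> b) \<noteq> 0"
    by (auto simp: cube_bump_def)
  then have "\<And>b. b \<in> Basis \<Longrightarrow> \<bar>x \<bullet> b\<bar> < d"
    by (force simp: exp_flat_def split: if_splits)
  \<comment> \<open>On the cube the l1 norm is below d times the dimension, and it dominates the
    Euclidean norm.\<close>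
  then have "(\<Sum>b\<in>Basis. \<bar>x \<bullet> b\<bar>) < (\<Sum>b\<in>(Basis::'a set). d)"
    by (intro sum_strict_mono) auto
  then show False using assms norm_le_l1[of x] by (simp add: mult.commute)
qed

lemma cube_bump_0_pos: "d > 0 \<Longrightarrow> cube_bump d 0 > 0"
  by (auto simp: cube_bump_def exp_flat_def intro!: prod_pos)

text \<open>For factors of modulus at most 1, the difference of two products is at most the sum of
  the differences of the factors. Each coordinate contributes two functions with Lipschitz constant
  2, hence the 4.\<close>

lemma cube_bump_lipschitz:
  fixes x y :: "'a::euclidean_space"
  shows "\<bar>cube_bump d x - cube_bump d y\<bar> \<le> 4 * DIM('a) * norm (x - y)"
proof -
  have "norm (cube_bump d x - cube_bump d y) \<le> (\<Sum>b\<in>(Basis::'a set).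
     norm (exp_flat 1 (d - x \<bullet> b) * exp_flat 1 (d + x \<bullet> b) - exp_flat 1 (d - y \<bullet> b) * exp_flat 1 (d + y \<bullet> b)))"
    unfolding cube_bump_def
    by (rule norm_prod_diff) (auto simp: abs_mult intro!: mult_le_one exp_flat_1_bounds abs_leI order_trans[OF _ exp_flat_1_bounds(1)])
  also have "\<dots> \<le> (\<Sum>b\<in>(Basis::'a set). 4 * norm (x - y))"
  proof (rule sum_mono)
    fix b :: 'a assume b: "b \<in> Basis"
    have l: "\<bar>x \<bullet> b - y \<bullet> b\<bar> \<le> norm (x - y)"
      using Basis_le_norm[OF b, of "x - y"] by (simp add: inner_diff_left)
    let ?p = "exp_flat 1 (d - x \<bullet> b)" and ?q = "exp_flat 1 (d + x \<bullet> b)"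
    let ?p' = "exp_flat 1 (d - y \<bullet> b)" and ?q' = "exp_flat 1 (d + y \<bullet> b)"
    have "\<bar>?p * ?q - ?p' * ?q'\<bar> = \<bar>?p * (?q - ?q') + ?q' * (?p - ?p')\<bar>"
      by (simp add: algebra_simps)
    also have "\<dots> \<le> \<bar>?p\<bar> * \<bar>?q - ?q'\<bar> + \<bar>?q'\<bar> * \<bar>?p - ?p'\<bar>"
      by (simp add: abs_mult[symmetric] abs_triangle_ineq)
    also have "\<dots> \<le> 1 * \<bar>?q - ?q'\<bar> + 1 * \<bar>?p - ?p'\<bar>"
      using exp_flat_1_bounds by (intro add_mono mult_right_mono) (auto simp: abs_le_iff intro: order_trans[of _ 0])
    also have "\<dots> \<le> 4 * norm (x - y)"
      using exp_flat_1_lipschitz[of "d - x \<bullet> b" "d - y \<bullet> b"]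
        exp_flat_1_lipschitz[of "d + x \<bullet> b" "d + y \<bullet> b"] l by (simp add: abs_minus_commute)
    finally show "norm (?p * ?q - ?p' * ?q') \<le> 4 * norm (x - y)" by simp
  qed
  finally show ?thesis by simp
qed

lemma cube_bump_translate_alg: "bump_alg (\<lambda>y. c * cube_bump d (y - x))"
proof -
  have "bump_alg (\<lambda>y. c * (\<Prod>b\<in>Basis. exp_flat 1 ((d + x \<bullet> b) + y \<bullet> (- b)) * exp_flat 1 ((d - x \<bullet> b) + y \<bullet> b)))"
    by (intro bump_alg.mult bump_alg.const bump_alg_prod bump_alg.flat) auto
  then show ?thesis
    by (simp add: cube_bump_def algebra_simps)
qed

section \<open>Radial integrals\<close>

text \<open>Polar coordinates from ball volumes alone: half-lines determine the measure, the left
  side gives them the volume of a ball, and the density is the derivative of that volume in the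
  radius.\<close>

lemma distr_norm_lborel:
  "distr (lborel :: 'a::euclidean_space measure) borel norm =
   density lborel (\<lambda>r. ennreal (DIM('a) * unit_ball_vol DIM('a) * r ^ (DIM('a) - 1)) * indicator {0..} r)"
    (is "?M = ?N")
proof (rule measure_eqI_generator_eq[where E = "range atMost" and \<Omega> = UNIV and A = "\<lambda>n. {..real n}"])
  show "Int_stable (range (atMost :: real \<Rightarrow> real set))"
    by (auto simp: Int_stable_def)
  show "sets ?M = sigma_sets UNIV (range atMost)" "sets ?N = sigma_sets UNIV (range atMost)"
    by (simp_all add: borel_eq_atMost)
  have M: "emeasure ?M {..r} = (if r \<ge> 0 then ennreal (unit_ball_vol DIM('a) * r ^ DIM('a)) else 0)" for r
  proof -
    have "norm -` {..r} = (cball 0 r :: 'a set)" by auto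
    then show ?thesis by (simp add: emeasure_distr emeasure_cball)
  qed
  have N: "emeasure ?N {..r} = (if r \<ge> 0 then ennreal (unit_ball_vol DIM('a) * r ^ DIM('a)) else 0)" for r
  proof -
    have "emeasure ?N {..r} = (\<integral>\<^sup>+x. ennreal (DIM('a) * unit_ball_vol DIM('a) * x ^ (DIM('a) - 1)) * indicator {0..r} x \<partial>lborel)"
      by (subst emeasure_density) (auto intro!: nn_integral_cong split: split_indicator)
    also have "\<dots> = (if r \<ge> 0 then ennreal (unit_ball_vol DIM('a) * r ^ DIM('a)) else 0)"
    proof (cases "r \<ge> 0")
      case True
      have "(\<integral>\<^sup>+x. ennreal (DIM('a) * unit_ball_vol DIM('a) * x ^ (DIM('a) - 1)) * indicator {0..r} x \<partial>lborel)
        = ennreal (unit_ball_vol DIM('a) * r ^ DIM('a) - unit_ball_vol DIM('a) * 0 ^ DIM('a))"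
        using True by (intro nn_integral_FTC_Icc) (auto intro!: derivative_eq_intros)
      then show ?thesis using True by simp
    qed simp
    finally show ?thesis .
  qed
  show "emeasure ?M X = emeasure ?N X" if "X \<in> range atMost" for X
    using that M N by auto
  show "(\<Union>i. {..real i}) = UNIV"
    by (auto intro: real_arch_simple)
  show "emeasure ?M {..real i} \<noteq> \<infinity>" for i
    by (simp add: M)
qed auto

lemma nn_integral_radial:
  assumes [measurable]: "f \<in> borel_measurable borel"
  shows "(\<integral>\<^sup>+z. f (norm z) \<partial>(lborel :: 'a::euclidean_space measure)) =
    (\<integral>\<^sup>+r. ennreal (DIM('a) * unit_ball_vol DIM('a) * r ^ (DIM('a) - 1)) * indicator {0..} r * f r \<partial>lborel)"
proof -
  have "(\<integral>\<^sup>+z. f (norm z) \<partial>(lborel :: 'a measure)) = (\<integral>\<^sup>+r. f r \<partial>(distr (lborel :: 'a measure) borel norm))"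
    by (simp add: nn_integral_distr)
  then show ?thesis
    by (simp add: distr_norm_lborel nn_integral_density)
qed

text \<open>The exponent is shifted so that the polar weight r^(N-1) turns the integrand into r^e.
  What remains is a one-dimensional integral times the area of the unit sphere.\<close>

lemma has_bochner_integral_radial_powr:
  fixes I :: "real set" and e J :: real
  assumes I: "I \<subseteq> {0..}" "I \<in> sets borel"
    and J: "((\<lambda>r. r powr e) has_integral J) I"
  shows "has_bochner_integral lborel
    (\<lambda>z::'a::euclidean_space. indicator I (norm z) * norm z powr (e + 1 - DIM('a))) (DIM('a) * unit_ball_vol DIM('a) * J)"
proof (rule has_bochner_integral_nn_integral)
  let ?c = "DIM('a) * unit_ball_vol DIM('a)"
  note [measurable] = I(2)
  have J0: "J \<ge> 0" using J by (rule has_integral_nonneg) simp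
  show "0 \<le> ?c * J" using J0 by simp
  show "(\<lambda>z::'a. indicator I (norm z) * norm z powr (e + 1 - DIM('a))) \<in> borel_measurable lborel"
    by measurable
  have "(\<integral>\<^sup>+z. ennreal (indicator I (norm z) * norm z powr (e + 1 - DIM('a))) \<partial>(lborel :: 'a measure)) =
    (\<integral>\<^sup>+r. ennreal (?c * r ^ (DIM('a) - 1)) * indicator {0..} r * ennreal (indicator I r * r powr (e + 1 - DIM('a))) \<partial>lborel)"
    by (rule nn_integral_radial) measurable
  also have "\<dots> = (\<integral>\<^sup>+r. ennreal ?c * ennreal (indicator I r * r powr e) \<partial>lborel)"
  proof (rule nn_integral_cong_AE, rule eventually_mono[OF AE_lborel_singleton[of "0::real"]])
    fix r :: real assume r: "r \<noteq> 0"
    show "ennreal (?c * r ^ (DIM('a) - 1)) * indicator {0..} r * ennreal (indicator I r * r powr (e + 1 - DIM('a))) =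
      ennreal ?c * ennreal (indicator I r * r powr e)"
    proof (cases "r \<in> I")
      case True
      then have "r > 0" using r I(1) by force
      have "r ^ (DIM('a) - 1) = r powr real (DIM('a) - 1)"
        using \<open>r > 0\<close> by (rule powr_realpow[symmetric])
      also have "real (DIM('a) - 1) = real DIM('a) - 1"
        by (simp add: of_nat_diff DIM_positive Suc_le_eq)
      finally have "r ^ (DIM('a) - 1) * r powr (e + 1 - DIM('a)) = r powr ((real DIM('a) - 1) + (e + 1 - DIM('a)))"
        by (simp only: powr_add)
      then have "r ^ (DIM('a) - 1) * r powr (e + 1 - DIM('a)) = r powr e"
        by simp
      then show ?thesis using True \<open>r > 0\<close>
        by (simp add: ennreal_mult'[symmetric] mult.assoc)
    qed simp
  qed
  also have "\<dots> = ennreal ?c * (\<integral>\<^sup>+r. ennreal (indicator I r * r powr e) \<partial>lborel)"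
    by (rule nn_integral_cmult) measurable
  also have "(\<integral>\<^sup>+r. ennreal (indicator I r * r powr e) \<partial>lborel) = ennreal J"
  proof (rule nn_integral_has_integral_lborel)
    show "((\<lambda>r. indicator I r * r powr e) has_integral J) UNIV"
    proof -
      have "(\<lambda>r. indicator I r * r powr e) = (\<lambda>r. if r \<in> I then r powr e else 0)"
        by (simp add: fun_eq_iff indicator_def)
      then show ?thesis using J by (simp only: has_integral_restrict_UNIV)
    qed
  qed auto
  finally show "(\<integral>\<^sup>+z. ennreal (indicator I (norm z) * norm z powr (e + 1 - DIM('a))) \<partial>(lborel :: 'a measure)) =
     ennreal (?c * J)"
    using J0 by (simp add: ennreal_mult)
qed auto

lemma has_bochner_integral_powr_tail:
  fixes t :: real
  assumes "t > 0"
  shows "has_bochner_integral lborel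
    (\<lambda>z::'a::euclidean_space. indicator {1..} (norm z) * norm z powr (- (DIM('a) + t)))
    (DIM('a) * unit_ball_vol DIM('a) / t)"
proof -
  have "((\<lambda>r. r powr (- 1 - t)) has_integral 1 / t) {1..}"
    using has_integral_powr_to_inf[of "- 1 - t" 1] assms by simp
  from has_bochner_integral_radial_powr[OF _ _ this, where 'a = 'a] show ?thesis
    by (simp add: add.commute)
qed

lemma has_bochner_integral_powr_ball:
  fixes t :: real
  assumes "t > 0"
  shows "has_bochner_integral lborel
    (\<lambda>z::'a::euclidean_space. indicator {0..1} (norm z) * norm z powr (t - DIM('a)))
    (DIM('a) * unit_ball_vol DIM('a) / t)"
proof -
  have "((\<lambda>r. r powr (t - 1)) has_integral 1 / t) {0..1}"
    using has_integral_powr_from_0[of "t - 1" 1] assms by simp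
  from has_bochner_integral_radial_powr[OF _ _ this, where 'a = 'a] show ?thesis
    by simp
qed

section \<open>The kernel of the fractional Laplacian\<close>

text \<open>Since \<open>powr\<close> has value 0 at base 0, the kernel is finite everywhere and
  vanishes at its singular point.\<close>

definition frac_kernel :: "real \<Rightarrow> 'a::euclidean_space \<Rightarrow> real" where
  "frac_kernel s z = norm z powr (- (real DIM('a) + 2 * s))"

lemma frac_kernel_nonneg [simp]: "0 \<le> frac_kernel s z"
  and frac_kernel_0 [simp]: "frac_kernel s 0 = 0"
  by (simp_all add: frac_kernel_def)

lemma frac_kernel_measurable [measurable]: "frac_kernel s \<in> borel_measurable borel"
  unfolding frac_kernel_def by measurable

lemma has_bochner_integral_frac_kernel_tail:
  assumes "s > 0"
  shows "has_bochner_integral lborel (\<lambda>z::'a::euclidean_space. indicator {1..} (norm z) * frac_kernel s z)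
    (DIM('a) * unit_ball_vol DIM('a) / (2 * s))"
  unfolding frac_kernel_def using assms by (intro has_bochner_integral_powr_tail) simp

text \<open>The factor \<open>norm z\<close> weakens the singularity to the exponent 1 - 2s - N,
  which is integrable at the origin when s < 1/2.\<close>

lemma has_bochner_integral_frac_kernel_ball:
  assumes "s < 1 / 2"
  shows "has_bochner_integral lborel (\<lambda>z::'a::euclidean_space. indicator {0..1} (norm z) * (norm z * frac_kernel s z))
    (DIM('a) * unit_ball_vol DIM('a) / (1 - 2 * s))"
proof -
  have "norm z * frac_kernel s z = norm z powr ((1 - 2 * s) - DIM('a))" for z :: 'a
  proof (cases "z = 0")
    case False
    then have "norm z * frac_kernel s z = norm z powr 1 * norm z powr (- (real DIM('a) + 2 * s))"
      by (simp add: frac_kernel_def)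
    also have "\<dots> = norm z powr ((1 - 2 * s) - DIM('a))"
      unfolding powr_add[symmetric] by (simp add: algebra_simps)
    finally show ?thesis .
  qed simp
  then show ?thesis
    using has_bochner_integral_powr_ball[of "1 - 2 * s", where 'a = 'a] assms by simp
qed

text \<open>The bound A handles the tail of the kernel, and the linear bound B its singularity
  inside the unit ball.\<close>

lemma integrable_mult_frac_kernel:
  fixes f :: "'a::euclidean_space \<Rightarrow> real"
  assumes s: "0 < s" "s < 1 / 2" and [measurable]: "f \<in> borel_measurable borel"
    and A: "\<And>z. \<bar>f z\<bar> \<le> A" and B: "\<And>z. \<bar>f z\<bar> \<le> B * norm z"
  shows "integrable lborel (\<lambda>z. f z * frac_kernel s z)"
proof (rule Bochner_Integration.integrable_bound)
  have [simp]: "integrable lborel (\<lambda>z::'a. indicator {1..} (norm z) * frac_kernel s z)"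
    "integrable lborel (\<lambda>z::'a. indicator {0..1} (norm z) * (norm z * frac_kernel s z))"
    using has_bochner_integral_frac_kernel_tail[OF s(1)] has_bochner_integral_frac_kernel_ball[OF s(2)]
    by (blast intro: integrable.intros)+
  show "integrable lborel (\<lambda>z::'a. A * (indicator {1..} (norm z) * frac_kernel s z) +
      B * (indicator {0..1} (norm z) * (norm z * frac_kernel s z)))"
    by (intro Bochner_Integration.integrable_add integrable_mult_right) simp_all
  have "A \<ge> 0" using A[of 0] by linarith
  obtain b :: 'a where "b \<in> Basis" using nonempty_Basis by blast
  then have "B \<ge> 0" using B[of b] by simp
  have "\<bar>f z * frac_kernel s z\<bar> \<le> A * (indicator {1..} (norm z) * frac_kernel s z) +
      B * (indicator {0..1} (norm z) * (norm z * frac_kernel s z))" for z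
  proof (cases "norm z \<ge> 1")
    case True
    then show ?thesis
      using \<open>B \<ge> 0\<close> A by (auto simp: abs_mult indicator_def intro!: mult_right_mono add_increasing2 mult_nonneg_nonneg)
  next
    case False
    then show ?thesis
      using B by (auto simp: abs_mult indicator_def mult.assoc[symmetric] intro!: mult_right_mono)
  qed
  then show "AE z in lborel. norm (f z * frac_kernel s z) \<le> norm (A * (indicator {1..} (norm z) * frac_kernel s z) +
      B * (indicator {0..1} (norm z) * (norm z * frac_kernel s z)))"
    by (auto intro: order_trans abs_ge_self)
qed measurable

section \<open>Translations, and the fractional Laplacian as an absolutely convergent
  integral\<close>

lemma lborel_distr_minus_const:
  fixes c :: "'a::euclidean_space"
  shows "distr lborel borel (\<lambda>z. c - z) = lborel"
  using lborel_affine[of "-1" c] by (simp add: density_1)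

lemma lborel_integral_minus_const:
  fixes f :: "'a::euclidean_space \<Rightarrow> real"
  assumes [measurable]: "f \<in> borel_measurable borel"
  shows "integrable lborel (\<lambda>z. f (c - z)) \<longleftrightarrow> integrable lborel f" "(\<integral>z. f (c - z) \<partial>lborel) = (\<integral>z. f z \<partial>lborel)"
  using integrable_distr_eq[of "\<lambda>z. c - z" lborel borel f] integral_distr[of "\<lambda>z. c - z" lborel borel f]
  by (simp_all add: lborel_distr_minus_const)

lemma lborel_integral_plus_const:
  fixes f :: "'a::euclidean_space \<Rightarrow> real"
  assumes [measurable]: "f \<in> borel_measurable borel"
  shows "integrable lborel (\<lambda>z. f (c + z)) \<longleftrightarrow> integrable lborel f" "(\<integral>z. f (c + z) \<partial>lborel) = (\<integral>z. f z \<partial>lborel)"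
  using integrable_distr_eq[of "\<lambda>z. c + z" lborel borel f] integral_distr[of "\<lambda>z. c + z" lborel borel f]
  by (simp_all add: lborel_distr_plus)

text \<open>For bounded Lipschitz \<phi> the untruncated integrand is already integrable, so the
  truncated integrals converge to its integral by dominated convergence. The substitution y = q - z
  gives the form that Fubini produces later for mollifications.\<close>

lemma frac_lap_eq_integral:
  fixes \<phi> :: "'a::euclidean_space \<Rightarrow> real"
  assumes s: "0 < s" "s < 1 / 2" and [measurable]: "\<phi> \<in> borel_measurable borel"
    and A: "\<And>z. \<bar>\<phi> z\<bar> \<le> A" and L: "\<And>x y. \<bar>\<phi> x - \<phi> y\<bar> \<le> L * norm (x - y)"
  shows "frac_lap s \<phi> q = frac_const DIM('a) s * (\<integral>z. (\<phi> q - \<phi> (q - z)) * frac_kernel s z \<partial>lborel)"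
proof -
  define F where "F y = (\<phi> q - \<phi> y) / dist q y powr (real DIM('a) + 2 * s)" for y
  have [measurable]: "F \<in> borel_measurable borel"
    unfolding F_def by measurable
  have F: "F (q - z) = (\<phi> q - \<phi> (q - z)) * frac_kernel s z" for z
    by (simp add: F_def frac_kernel_def dist_norm powr_minus divide_inverse del: minus_add_distrib)
  have "integrable lborel (\<lambda>z. F (q - z))"
    unfolding F
  proof (rule integrable_mult_frac_kernel[OF s])
    show "\<bar>\<phi> q - \<phi> (q - z)\<bar> \<le> 2 * A" for z
      using A[of q] A[of "q - z"] by linarith
    show "\<bar>\<phi> q - \<phi> (q - z)\<bar> \<le> L * norm z" for z
      using L[of q "q - z"] by simp
  qed measurable
  then have iF: "integrable lborel F"
    by (simp add: lborel_integral_minus_const)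
  have "((\<lambda>\<epsilon>. \<integral>y. indicator {y. \<epsilon> < dist q y} y * F y \<partial>lebesgue) \<longlongrightarrow> (\<integral>y. F y \<partial>lborel)) (at_right 0)"
  proof (rule tendsto_at_right_sequentially[of 0 1])
    fix S :: "nat \<Rightarrow> real" assume S: "\<And>n. 0 < S n" "S \<longlonglongrightarrow> 0"
    have "(\<lambda>n. \<integral>y. indicator {y. S n < dist q y} y * F y \<partial>lborel) \<longlonglongrightarrow> (\<integral>y. F y \<partial>lborel)"
    proof (rule integral_dominated_convergence[where w = "\<lambda>y. \<bar>F y\<bar>"])
      \<comment> \<open>A point y other than q is kept once \<open>S n\<close> is below its distance
        to q; at y = q the numerator of F vanishes.\<close>
      show "AE y in lborel. (\<lambda>n. indicator {y. S n < dist q y} y * F y) \<longlonglongrightarrow> F y"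
      proof (rule AE_I2)
        fix y
        show "(\<lambda>n. indicator {y. S n < dist q y} y * F y) \<longlonglongrightarrow> F y"
        proof (cases "y = q")
          case False
          then have "eventually (\<lambda>n. S n < dist q y) sequentially"
            using order_tendstoD(2)[OF S(2), of "dist q y"] by simp
          then have "eventually (\<lambda>n. indicator {y. S n < dist q y} y * F y = F y) sequentially"
            by (rule eventually_mono) simp
          then show ?thesis by (rule tendsto_eventually)
        qed (simp add: F_def)
      qed
      show "integrable lborel (\<lambda>y. \<bar>F y\<bar>)" using iF by simp
    qed (auto simp: indicator_def)
    then show "(\<lambda>n. \<integral>y. indicator {y. S n < dist q y} y * F y \<partial>lebesgue) \<longlonglongrightarrow> (\<integral>y. F y \<partial>lborel)"
      by (subst integral_completion) auto
  qed simp
  then have "Lim (at_right 0) (\<lambda>\<epsilon>. \<integral>y. indicator {y. \<epsilon> < dist q y} y * F y \<partial>lebesgue) = (\<integral>y. F y \<partial>lborel)"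
    by (rule tendsto_Lim[rotated]) simp
  also have "\<dots> = (\<integral>z. F (q - z) \<partial>lborel)"
    by (simp add: lborel_integral_minus_const)
  finally show ?thesis
    unfolding frac_lap_def F by (simp add: F_def)
qed

section \<open>Maximum principle and oscillation bound\<close>

lemma abs_powr_minus_diff_le:
  fixes a b c m :: real
  assumes "c > 0" "c \<le> a" "c \<le> b" "m \<ge> 0"
  shows "\<bar>a powr (- m) - b powr (- m)\<bar> \<le> m * c powr (- m - 1) * \<bar>a - b\<bar>"
proof -
  have "norm (a powr (- m) - b powr (- m)) \<le> m * c powr (- m - 1) * norm (a - b)"
  proof (rule field_differentiable_bound[where S = "{c..}" and f = "\<lambda>x. x powr (- m)"])
    fix x assume x: "x \<in> {c..}"
    then show "((\<lambda>x. x powr (- m)) has_field_derivative - m * x powr (- m - 1)) (at x within {c..})"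
      using assms by (auto intro!: derivative_eq_intros)
    have "x powr (- m - 1) \<le> c powr (- m - 1)"
      using x assms by (intro powr_mono2') auto
    then show "norm (- m * x powr (- m - 1)) \<le> m * c powr (- m - 1)"
      using assms by (simp add: abs_mult mult_left_mono)
  qed (use assms in auto)
  then show ?thesis by simp
qed

definition frac_tail :: "real \<Rightarrow> 'a::euclidean_space \<Rightarrow> real" where
  "frac_tail s z = indicator {1..} (norm z) * frac_kernel s z"

lemma frac_tail_measurable [measurable]: "frac_tail s \<in> borel_measurable borel"
  unfolding frac_tail_def by measurable

lemma frac_tail_nonneg: "0 \<le> frac_tail s z"
  by (simp add: frac_tail_def)

lemma integrable_frac_tail: "s > 0 \<Longrightarrow> integrable lborel (frac_tail s)"
  using has_bochner_integral_frac_kernel_tail[of s] unfolding frac_tail_def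
  by (rule integrable.intros)

lemma frac_tail_le_1:
  assumes "s > 0"
  shows "frac_tail s z \<le> 1"
proof (cases "norm z \<ge> 1")
  case True
  then have "norm z powr (- (real DIM('a) + 2 * s)) \<le> norm z powr 0"
    using assms by (intro powr_mono) auto
  moreover have "z \<noteq> 0" using True by auto
  ultimately show ?thesis using True by (simp add: frac_tail_def frac_kernel_def)
qed (simp add: frac_tail_def)

text \<open>Each translate has mass of order 1/s, yet E is independent of s: a difference of
  translates decays one power faster than the kernel itself, so it is integrable at infinity
  uniformly in s. The jumps across the unit spheres stay in a bounded region, where the difference
  is at most 1.\<close>

lemma frac_tail_translate_bound:
  fixes D :: real
  assumes "D \<ge> 0"
  obtains E where "E \<ge> 0"
    "\<And>s x y :: 'a::euclidean_space. 0 < s \<Longrightarrow> s \<le> 1 / 2 \<Longrightarrow> norm (x - y) \<le> D \<Longrightarrow>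
       (\<integral>z. \<bar>frac_tail s (z - x) - frac_tail s (z - y)\<bar> \<partial>lborel) \<le> E"
proof
  define T where "T z = indicator {1..} (norm z) * norm z powr (- (real DIM('a) + 1))" for z :: 'a
  \<comment> \<open>The indicator covers the bounded region. The other constants come from the mean
    value bound for the exponent m = N + 2s, where s <= 1/2 gives m <= N + 1 and m + 1 <= N +
    2.\<close>
  define H where "H z = indicator (cball 0 (2 * D + 1)) z + (DIM('a) + 1) * 2 powr (DIM('a) + 2) * D * T z" for z :: 'a
  have [measurable]: "T \<in> borel_measurable borel" unfolding T_def by measurable
  have [measurable]: "cball 0 (2 * D + 1) \<in> sets (borel :: 'a measure)" by simp
  have [measurable]: "H \<in> borel_measurable borel" unfolding H_def by measurable
  have iT: "integrable lborel T"
    using has_bochner_integral_powr_tail[of 1, where 'a = 'a] unfolding T_def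
    by (auto intro: integrable.intros)
  have iH: "integrable lborel H"
    unfolding H_def by (intro Bochner_Integration.integrable_add integrable_mult_right iT)
      (simp add: emeasure_cball \<open>D \<ge> 0\<close>)
  have H0: "H z \<ge> 0" for z
    using \<open>D \<ge> 0\<close> by (simp add: H_def T_def)
  show "integral\<^sup>L lborel H \<ge> 0"
    using H0 by simp
  fix s :: real and x y :: 'a
  assume s: "0 < s" "s \<le> 1 / 2" and xy: "norm (x - y) \<le> D"
  have b: "\<bar>frac_tail s (z - x) - frac_tail s (z - y)\<bar> \<le> H (- x + z)" for z
  proof (cases "norm (z - x) \<le> 2 * D + 1")
    case True
    have "\<bar>frac_tail s (z - x) - frac_tail s (z - y)\<bar> \<le> 1"
      using frac_tail_le_1[OF s(1), of "z - x"] frac_tail_le_1[OF s(1), of "z - y"]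
        frac_tail_nonneg[of s "z - x"] frac_tail_nonneg[of s "z - y"] by linarith
    also have "\<dots> \<le> H (- x + z)"
      using True \<open>D \<ge> 0\<close> by (simp add: H_def T_def)
    finally show ?thesis .
  next
    case False
    define a b m where "a = norm (z - x)" and "b = norm (z - y)" and "m = real DIM('a) + 2 * s"
    have a: "a > 2 * D + 1" using False by (simp add: a_def)
    have ab: "\<bar>a - b\<bar> \<le> D"
      using norm_triangle_ineq3[of "z - x" "z - y"] xy by (simp add: a_def b_def norm_minus_commute)
    \<comment> \<open>Both distances are at least 1, so neither tail is cut off, and both are at
      least a / 2, the base point of the mean value bound.\<close>
    then have b: "b \<ge> 1" "b \<ge> a / 2" using a \<open>D \<ge> 0\<close> by linarith+
    have "\<bar>frac_tail s (z - x) - frac_tail s (z - y)\<bar> = \<bar>a powr (- m) - b powr (- m)\<bar>"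
      using a b \<open>D \<ge> 0\<close> by (simp add: frac_tail_def frac_kernel_def a_def b_def m_def)
    also have "\<dots> \<le> m * (a / 2) powr (- m - 1) * \<bar>a - b\<bar>"
      using a b \<open>D \<ge> 0\<close> s by (intro abs_powr_minus_diff_le) (auto simp: m_def)
    also have "\<dots> \<le> (DIM('a) + 1) * (2 powr (DIM('a) + 2) * a powr (- (real DIM('a) + 1))) * D"
    proof -
      have "(a / 2) powr (- m - 1) = 2 powr (m + 1) * a powr (- m - 1)"
      proof -
        have "2 powr (m + 1) = 1 / 2 powr (- m - 1)"
          using powr_minus_divide[of 2 "- m - 1"] by (simp add: add.commute)
        then show ?thesis
          using a \<open>D \<ge> 0\<close> by (simp add: powr_divide del: powr_minus_divide)
      qed
      also have "\<dots> \<le> 2 powr (DIM('a) + 2) * a powr (- (real DIM('a) + 1))"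
        using a \<open>D \<ge> 0\<close> s by (intro mult_mono powr_mono) (auto simp: m_def)
      finally show ?thesis
        using ab s by (intro mult_mono) (auto simp: m_def)
    qed
    also have "\<dots> \<le> H (- x + z)"
      using a \<open>D \<ge> 0\<close> by (simp add: H_def T_def a_def)
    finally show ?thesis .
  qed
  have "(\<integral>z. \<bar>frac_tail s (z - x) - frac_tail s (z - y)\<bar> \<partial>lborel) \<le> (\<integral>z. H (- x + z) \<partial>lborel)"
  proof (rule integral_mono')
    show "integrable lborel (\<lambda>z. H (- x + z))"
      using iH by (subst lborel_integral_plus_const) auto
  qed (use b H0 in auto)
  also have "\<dots> = integral\<^sup>L lborel H"
    by (rule lborel_integral_plus_const) measurable
  finally show "(\<integral>z. \<bar>frac_tail s (z - x) - frac_tail s (z - y)\<bar> \<partial>lborel) \<le> integral\<^sup>L lborel H" .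
qed

text \<open>The cone \<open>3 * C / r * norm (x - x0)\<close> is steep enough for \<open>w\<close> minus the cone to attain its
  maximum at some \<open>x1\<close> in the ball; there the cone, rather than the regularity of \<open>w\<close>, controls the
  singular part of the integral.\<close>

lemma frac_max_principle:
  fixes w :: "'a::euclidean_space \<Rightarrow> real"
  assumes s: "0 < s" "s \<le> 1 / 4" and r: "r > 0" and C: "C > 0" "\<And>x. \<bar>w x\<bar> \<le> C"
    and cont: "continuous_on UNIV w"
    and int: "\<And>x. norm (x - x0) < r \<Longrightarrow> integrable lborel (\<lambda>z. (w x - w (x + z)) * frac_kernel s z)"
    and eq: "\<And>x. norm (x - x0) < r \<Longrightarrow> (\<integral>z. (w x - w (x + z)) * frac_kernel s z \<partial>lborel) = 0"
  obtains x1 where "norm (x1 - x0) < r"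
    "w x0 * (DIM('a) * unit_ball_vol DIM('a) / (2 * s)) \<le>
      (\<integral>z. w (x1 + z) * frac_tail s z \<partial>lborel) + 6 * C / r * (DIM('a) * unit_ball_vol DIM('a))"
proof -
  define B where "B = 3 * C / r"
  define v where "v x = w x - B * norm (x - x0)" for x
  let ?V = "real DIM('a) * unit_ball_vol DIM('a)"
  have B: "B > 0" using r C by (simp add: B_def)
  have [measurable]: "w \<in> borel_measurable borel"
    using cont by (rule borel_measurable_continuous_onI)
  have "continuous_on (cball x0 r) v"
    unfolding v_def by (intro continuous_intros continuous_on_subset[OF cont]) auto
  then obtain x1 where x1: "x1 \<in> cball x0 r" "\<And>x. x \<in> cball x0 r \<Longrightarrow> v x \<le> v x1"
    using continuous_attains_sup[of "cball x0 r" v] r by auto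
  have x0: "v x0 \<le> v x1" using x1(2)[of x0] r by simp
  \<comment> \<open>At distance r or more the cone costs at least 3C, so v is at most -2C there,
    while its value at x0 is at least -C.\<close>
  have far: "v x < v x1" if "norm (x - x0) \<ge> r" for x
  proof -
    have "B * r \<le> B * norm (x - x0)" using that B by (intro mult_left_mono) auto
    then have "v x \<le> C - 3 * C" using C(2)[of x] r by (simp add: v_def B_def)
    also have "\<dots> < - C" using C by simp
    also have "\<dots> \<le> v x0" using C(2)[of x0] by (simp add: v_def)
    finally show ?thesis using x0 by simp
  qed
  have x1r: "norm (x1 - x0) < r"
    using far[of x1] by force
  have max: "v x \<le> v x1" for x
    using far[of x] x1(2)[of x] by (force simp: dist_norm norm_minus_commute)
  have lower: "w x1 - w (x1 + z) \<ge> - (B * norm z)" for z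
  proof -
    have "B * (norm (x1 + z - x0) - norm (x1 - x0)) \<le> B * norm z"
      using B norm_triangle_ineq[of "x1 - x0" z] by (intro mult_left_mono) (auto simp: algebra_simps)
    then show ?thesis using max[of "x1 + z"] by (simp add: v_def algebra_simps)
  qed
  have ball: "has_bochner_integral lborel (\<lambda>z::'a. indicator {0..1} (norm z) * (norm z * frac_kernel s z)) (?V / (1 - 2 * s))"
    using s by (intro has_bochner_integral_frac_kernel_ball) auto
  have tail: "has_bochner_integral lborel (frac_tail s :: 'a \<Rightarrow> real) (?V / (2 * s))"
    unfolding frac_tail_def using s by (intro has_bochner_integral_frac_kernel_tail) auto
  have wtail: "integrable lborel (\<lambda>z. w (x1 + z) * frac_tail s z)"
  proof (rule Bochner_Integration.integrable_bound[where f = "\<lambda>z. C * frac_tail s z"])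
    show "integrable lborel (\<lambda>z::'a. C * frac_tail s z)"
      using tail by (auto intro: integrable.intros)
    show "AE z in lborel. norm (w (x1 + z) * frac_tail s z) \<le> norm (C * frac_tail s z)"
      using C by (auto simp: abs_mult intro!: mult_right_mono abs_ge_self order_trans[OF C(2)])
  qed measurable
  \<comment> \<open>The minorant keeps the exact integrand for \<open>norm z\<close> at least 1 and
    uses the cone bound inside. On the unit sphere both indicators are 1, where the extra subtracted
    term only lowers the minorant.\<close>
  have lowint: "has_bochner_integral lborel
      (\<lambda>z. w x1 * frac_tail s z - w (x1 + z) * frac_tail s z - B * (indicator {0..1} (norm z) * (norm z * frac_kernel s z)))
      (w x1 * (?V / (2 * s)) - (\<integral>z. w (x1 + z) * frac_tail s z \<partial>lborel) - B * (?V / (1 - 2 * s)))"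
    by (intro has_bochner_integral_diff has_bochner_integral_mult_right tail ball
        has_bochner_integral_integrable wtail)
  have "w x1 * (?V / (2 * s)) - (\<integral>z. w (x1 + z) * frac_tail s z \<partial>lborel) - B * (?V / (1 - 2 * s))
      \<le> (\<integral>z. (w x1 - w (x1 + z)) * frac_kernel s z \<partial>lborel)"
    unfolding has_bochner_integral_integral_eq[OF lowint, symmetric]
  proof (rule integral_mono)
    fix z :: 'a
    have "- (B * norm z) * frac_kernel s z \<le> (w x1 - w (x1 + z)) * frac_kernel s z"
      using lower by (intro mult_right_mono) auto
    moreover have "0 \<le> B * norm z * frac_kernel s z"
      using B by simp
    ultimately show "w x1 * frac_tail s z - w (x1 + z) * frac_tail s z - B * (indicator {0..1} (norm z) * (norm z * frac_kernel s z))
      \<le> (w x1 - w (x1 + z)) * frac_kernel s z"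
      by (auto simp: frac_tail_def indicator_def algebra_simps)
  qed (use lowint int[OF x1r] in \<open>auto intro: integrable.intros\<close>)
  also have "\<dots> = 0" by (rule eq[OF x1r])
  finally have "w x1 * (?V / (2 * s)) \<le> (\<integral>z. w (x1 + z) * frac_tail s z \<partial>lborel) + B * (?V / (1 - 2 * s))"
    by simp
  \<comment> \<open>Here s <= 1/4 enters: 1 - 2s is at least 1/2, which doubles B = 3C/r to
    6C/r.\<close>
  also have "B * (?V / (1 - 2 * s)) \<le> B * (?V / (1 / 2))"
    using B s by (intro mult_left_mono divide_left_mono) auto
  also have "\<dots> = 6 * C / r * ?V"
    by (simp add: B_def)
  finally have "w x1 * (?V / (2 * s)) \<le> (\<integral>z. w (x1 + z) * frac_tail s z \<partial>lborel) + 6 * C / r * ?V"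
    by simp
  moreover have "w x0 * (?V / (2 * s)) \<le> w x1 * (?V / (2 * s))"
  proof (intro mult_right_mono)
    show "w x0 \<le> w x1"
    proof -
      have "0 \<le> B * norm (x1 - x0)" using B by simp
      then show ?thesis using x0 by (simp add: v_def)
    qed
    show "0 \<le> ?V / (2 * s)" using s by simp
  qed
  ultimately show ?thesis
    using that x1r by fastforce
qed

text \<open>Of the size and regularity of w only the bound C enters Q, with no modulus of
  continuity, so one Q serves every mollification scale and every s.\<close>

lemma frac_oscillation_bound:
  fixes C r D :: real
  assumes C: "C > 0" and r: "r > 0" and D: "D \<ge> 0"
  obtains Q where "Q \<ge> 0"
    "\<And>s (w :: 'a::euclidean_space \<Rightarrow> real) x0 y0.
       \<lbrakk>0 < s; s \<le> 1 / 4; continuous_on UNIV w; \<And>x. \<bar>w x\<bar> \<le> C; norm (x0 - y0) \<le> D;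
        \<And>x. norm (x - x0) < r \<or> norm (x - y0) < r \<Longrightarrow>
          has_bochner_integral lborel (\<lambda>z. (w x - w (x + z)) * frac_kernel s z) 0\<rbrakk> \<Longrightarrow> w x0 - w y0 \<le> Q * s"
proof -
  let ?V = "real DIM('a) * unit_ball_vol DIM('a)"
  have V: "?V > 0" by (simp add: DIM_positive)
  obtain E where E: "E \<ge> 0"
    "\<And>s x y :: 'a. 0 < s \<Longrightarrow> s \<le> 1 / 2 \<Longrightarrow> norm (x - y) \<le> D + 2 * r \<Longrightarrow>
       (\<integral>z. \<bar>frac_tail s (z - x) - frac_tail s (z - y)\<bar> \<partial>lborel) \<le> E"
    using frac_tail_translate_bound[of "D + 2 * r", where 'a = 'a] D r by auto
  \<comment> \<open>The two maximum principles contribute an error 6C/r times \<open>?V\<close>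
    each, and the comparison of the tails contributes C E. Dividing by the mass
    \<open>?V / (2 * s)\<close> gives the prefactor.\<close>
  define Q where "Q = 2 / ?V * (C * E + 12 * C / r * ?V)"
  have "Q \<ge> 0" using V C r E by (simp add: Q_def)
  moreover have "w x0 - w y0 \<le> Q * s"
    if s: "0 < s" "s \<le> 1 / 4" and cont: "continuous_on UNIV w" and w: "\<And>x. \<bar>w x\<bar> \<le> C"
      and xy: "norm (x0 - y0) \<le> D"
      and eq: "\<And>x. norm (x - x0) < r \<or> norm (x - y0) < r \<Longrightarrow>
          has_bochner_integral lborel (\<lambda>z. (w x - w (x + z)) * frac_kernel s z) 0"
    for s and w :: "'a \<Rightarrow> real" and x0 y0
  proof -
    have [measurable]: "w \<in> borel_measurable borel"
      using cont by (rule borel_measurable_continuous_onI)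
    obtain x1 where x1: "norm (x1 - x0) < r"
      "w x0 * (?V / (2 * s)) \<le> (\<integral>z. w (x1 + z) * frac_tail s z \<partial>lborel) + 6 * C / r * ?V"
    proof (rule frac_max_principle[OF s r C w cont])
      fix x assume "norm (x - x0) < r"
      with eq[of x] show "integrable lborel (\<lambda>z. (w x - w (x + z)) * frac_kernel s z)"
        "(\<integral>z. (w x - w (x + z)) * frac_kernel s z \<partial>lborel) = 0"
        by (auto simp: has_bochner_integral_iff)
    qed auto
    \<comment> \<open>The lower bound at y0 is the upper bound for -w.\<close>
    obtain y1 where y1: "norm (y1 - y0) < r"
      "- w y0 * (?V / (2 * s)) \<le> (\<integral>z. - w (y1 + z) * frac_tail s z \<partial>lborel) + 6 * C / r * ?V"
    proof (rule frac_max_principle[OF s r C, of "\<lambda>x. - w x" y0])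
      fix x assume "norm (x - y0) < r"
      then have "has_bochner_integral lborel (\<lambda>z. - ((w x - w (x + z)) * frac_kernel s z)) (- 0)"
        using eq[of x] by (intro has_bochner_integral_minus) auto
      then show "integrable lborel (\<lambda>z. (- w x - - w (x + z)) * frac_kernel s z)"
        "(\<integral>z. (- w x - - w (x + z)) * frac_kernel s z \<partial>lborel) = 0"
        by (auto simp: has_bochner_integral_iff algebra_simps)
    qed (use w cont in \<open>auto intro: continuous_intros\<close>)
    \<comment> \<open>Moving the translation from w onto the tail lets both integrals be taken
      against the same w, so only the difference of two translated tails remains.\<close>
    have shift: "integrable lborel (\<lambda>y. w y * frac_tail s (y - x))"
      "(\<integral>z. w (x + z) * frac_tail s z \<partial>lborel) = (\<integral>y. w y * frac_tail s (y - x) \<partial>lborel)" for x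
    proof -
      have t: "integrable lborel (\<lambda>y. frac_tail s (- x + y))"
        using s by (subst lborel_integral_plus_const) (auto intro: integrable_frac_tail)
      show "integrable lborel (\<lambda>y. w y * frac_tail s (y - x))"
      proof (rule Bochner_Integration.integrable_bound[where f = "\<lambda>y. C * frac_tail s (- x + y)"])
        show "AE y in lborel. norm (w y * frac_tail s (y - x)) \<le> norm (C * frac_tail s (- x + y))"
          using w C by (auto simp: abs_mult intro!: mult_right_mono)
      qed (use t in auto)
      show "(\<integral>z. w (x + z) * frac_tail s z \<partial>lborel) = (\<integral>y. w y * frac_tail s (y - x) \<partial>lborel)"
        using lborel_integral_plus_const(2)[of "\<lambda>y. w y * frac_tail s (y - x)" x] by simp
    qed
    have "(\<integral>z. w (x1 + z) * frac_tail s z \<partial>lborel) - (\<integral>z. w (y1 + z) * frac_tail s z \<partial>lborel)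
       = (\<integral>y. w y * (frac_tail s (y - x1) - frac_tail s (y - y1)) \<partial>lborel)"
      unfolding shift(2) by (simp add: Bochner_Integration.integral_diff[OF shift(1) shift(1), symmetric] right_diff_distrib)
    also have "\<dots> \<le> (\<integral>y. C * \<bar>frac_tail s (y - x1) - frac_tail s (y - y1)\<bar> \<partial>lborel)"
    proof (rule integral_mono)
      show "integrable lborel (\<lambda>y. w y * (frac_tail s (y - x1) - frac_tail s (y - y1)))"
        using Bochner_Integration.integrable_diff[OF shift(1)[of x1] shift(1)[of y1]] by (simp add: right_diff_distrib)
      have "integrable lborel (\<lambda>y. frac_tail s (- x + y))" for x :: 'a
        using s by (subst lborel_integral_plus_const) (auto intro: integrable_frac_tail)
      then show "integrable lborel (\<lambda>y. C * \<bar>frac_tail s (y - x1) - frac_tail s (y - y1)\<bar>)"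
        by (intro integrable_mult_right integrable_abs Bochner_Integration.integrable_diff) auto
      fix y
      have "w y * (frac_tail s (y - x1) - frac_tail s (y - y1)) \<le> \<bar>w y\<bar> * \<bar>frac_tail s (y - x1) - frac_tail s (y - y1)\<bar>"
        by (metis abs_ge_self abs_mult)
      also have "\<dots> \<le> C * \<bar>frac_tail s (y - x1) - frac_tail s (y - y1)\<bar>"
        using w by (intro mult_right_mono) auto
      finally show "w y * (frac_tail s (y - x1) - frac_tail s (y - y1)) \<le> C * \<bar>frac_tail s (y - x1) - frac_tail s (y - y1)\<bar>" .
    qed
    also have "\<dots> \<le> C * E"
    proof -
      have "norm (x1 - y1) \<le> norm (x1 - x0) + norm (x0 - y0) + norm (y1 - y0)"
        using norm_triangle_ineq[of "x1 - x0" "x0 - y0"] norm_triangle_ineq4[of "x1 - y0" "y1 - y0"] by simp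
      then have "norm (x1 - y1) \<le> D + 2 * r" using x1(1) y1(1) xy by simp
      with E(2)[of s x1 y1] s C show ?thesis by simp
    qed
    finally have "(\<integral>z. w (x1 + z) * frac_tail s z \<partial>lborel) - (\<integral>z. w (y1 + z) * frac_tail s z \<partial>lborel) \<le> C * E" .
    moreover have "(\<integral>z. - w (y1 + z) * frac_tail s z \<partial>lborel) = - (\<integral>z. w (y1 + z) * frac_tail s z \<partial>lborel)"
      by simp
    moreover define M c where "M = ?V / (2 * s)" and "c = 6 * C / r * ?V"
    ultimately have "(w x0 - w y0) * M \<le> C * E + 2 * c"
      using x1(2) y1(2) unfolding M_def[symmetric] c_def[symmetric] left_diff_distrib mult_minus_left
      by linarith
    then have "(w x0 - w y0) * (?V / (2 * s)) \<le> C * E + 12 * C / r * ?V"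
      by (simp add: M_def c_def)
    moreover have "a \<le> 2 / k * b * s" if "a * (k / (2 * s)) \<le> b" "k > 0" for a b k :: real
      using that s by (simp add: field_simps)
    ultimately show ?thesis
      unfolding Q_def using V by blast
  qed
  ultimately show ?thesis by (rule that)
qed

section \<open>Mollification\<close>

locale mollification =
  fixes v \<eta> :: "'a::euclidean_space \<Rightarrow> real" and C L d :: real
  assumes v_measurable [measurable]: "v \<in> borel_measurable borel"
    and v_bound: "\<And>x. \<bar>v x\<bar> \<le> C"
    and \<eta>_measurable [measurable]: "\<eta> \<in> borel_measurable borel"
    and \<eta>_nonneg: "\<And>x. 0 \<le> \<eta> x"
    and \<eta>_lipschitz: "\<And>x y. \<bar>\<eta> x - \<eta> y\<bar> \<le> L * norm (x - y)"
    and \<eta>_support: "\<And>x. norm x \<ge> d \<Longrightarrow> \<eta> x = 0"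
    and d_pos: "d > 0"
    and \<eta>_integral: "has_bochner_integral lborel \<eta> 1"
begin

text \<open>The weight is \<eta>(q - x) rather than \<eta>(x - q), so that as a function of q it is
  the translated bump that later serves as the test function.\<close>

definition moll :: "'a \<Rightarrow> real" where
  "moll x = (\<integral>q. v q * \<eta> (q - x) \<partial>lborel)"

lemma C_nonneg: "0 \<le> C"
  using v_bound[of 0] by linarith

lemma L_nonneg: "0 \<le> L"
proof -
  obtain b :: 'a where "b \<in> Basis" using nonempty_Basis by blast
  then show ?thesis using \<eta>_lipschitz[of b 0] abs_ge_zero[of "\<eta> b - \<eta> 0"] by simp
qed

lemma \<eta>_translate: "has_bochner_integral lborel (\<lambda>q. \<eta> (q - x)) 1"
  using \<eta>_integral lborel_integral_plus_const[of \<eta> "- x"] by (simp add: has_bochner_integral_iff)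

lemma integrable_v_\<eta>: "integrable lborel (\<lambda>q. v q * \<eta> (q - x))"
proof (rule Bochner_Integration.integrable_bound[where f = "\<lambda>q. C * \<eta> (q - x)"])
  show "integrable lborel (\<lambda>q. C * \<eta> (q - x))"
    using \<eta>_translate by (auto intro: integrable.intros)
  show "AE q in lborel. norm (v q * \<eta> (q - x)) \<le> norm (C * \<eta> (q - x))"
    using v_bound C_nonneg \<eta>_nonneg by (auto simp: abs_mult intro!: mult_right_mono)
qed measurable

text \<open>The first bound uses the unit mass of each translate, the second the Lipschitz constant
  on the two supporting balls. Together they are the two bounds that
  \<open>integrable_mult_frac_kernel\<close> asks for.\<close>

lemma integral_difference_le:
  "(\<integral>q. \<bar>v q * (\<eta> (q - x) - \<eta> (q - y))\<bar> \<partial>lborel) \<le> 2 * C"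
  "(\<integral>q. \<bar>v q * (\<eta> (q - x) - \<eta> (q - y))\<bar> \<partial>lborel) \<le> 2 * C * L * measure lborel (cball 0 d :: 'a set) * norm (x - y)"
proof -
  have "(\<integral>q. \<bar>v q * (\<eta> (q - x) - \<eta> (q - y))\<bar> \<partial>lborel) \<le> (\<integral>q. C * (\<eta> (q - x) + \<eta> (q - y)) \<partial>lborel)"
  proof (rule integral_mono')
    show "integrable lborel (\<lambda>q. C * (\<eta> (q - x) + \<eta> (q - y)))"
      using \<eta>_translate by (intro integrable_mult_right Bochner_Integration.integrable_add) (auto intro: integrable.intros)
    show "\<bar>v q * (\<eta> (q - x) - \<eta> (q - y))\<bar> \<le> C * (\<eta> (q - x) + \<eta> (q - y))" for q
      unfolding abs_mult using v_bound C_nonneg \<eta>_nonneg[of "q - x"] \<eta>_nonneg[of "q - y"]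
      by (intro mult_mono) auto
  qed (use C_nonneg \<eta>_nonneg in auto)
  also have "\<dots> = C * (1 + 1)"
    using has_bochner_integral_mult_right[OF has_bochner_integral_add[OF \<eta>_translate[of x] \<eta>_translate[of y]], of C]
    by (simp add: has_bochner_integral_iff)
  finally show "(\<integral>q. \<bar>v q * (\<eta> (q - x) - \<eta> (q - y))\<bar> \<partial>lborel) \<le> 2 * C" by simp
  have I: "has_bochner_integral lborel (indicator (cball x d) :: 'a \<Rightarrow> real) (measure lborel (cball 0 d :: 'a set))" for x :: 'a
    using d_pos by (auto simp: has_bochner_integral_iff emeasure_cball content_cball)
  have "(\<integral>q. \<bar>v q * (\<eta> (q - x) - \<eta> (q - y))\<bar> \<partial>lborel) \<le>
      (\<integral>q. (C * (L * norm (x - y))) * (indicator (cball x d) q + indicator (cball y d) q) \<partial>lborel)"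
  proof (rule integral_mono')
    show "integrable lborel (\<lambda>q. (C * (L * norm (x - y))) * (indicator (cball x d) q + indicator (cball y d) q))"
      using I by (intro integrable_mult_right Bochner_Integration.integrable_add) (auto intro: integrable.intros)
    show "\<bar>v q * (\<eta> (q - x) - \<eta> (q - y))\<bar> \<le> (C * (L * norm (x - y))) * (indicator (cball x d) q + indicator (cball y d) q)" for q
    proof (cases "q \<in> cball x d \<or> q \<in> cball y d")
      case True
      have "\<bar>v q * (\<eta> (q - x) - \<eta> (q - y))\<bar> \<le> C * (L * norm (x - y))"
        unfolding abs_mult using v_bound[of q] \<eta>_lipschitz[of "q - x" "q - y"] C_nonneg
        by (intro mult_mono) (auto simp: norm_minus_commute)
      also have "\<dots> \<le> (C * (L * norm (x - y))) * (indicator (cball x d) q + indicator (cball y d) q)"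
        using True C_nonneg L_nonneg mult_nonneg_nonneg[of C "L * norm (x - y)"]
        by (auto simp: indicator_def)
      finally show ?thesis .
    next
      case False
      then have "\<eta> (q - x) = 0" "\<eta> (q - y) = 0"
        by (auto intro!: \<eta>_support simp: dist_norm norm_minus_commute)
      then show ?thesis using C_nonneg L_nonneg by simp
    qed
  qed (use C_nonneg L_nonneg in simp)
  also have "\<dots> = (C * (L * norm (x - y))) * (measure lborel (cball 0 d :: 'a set) + measure lborel (cball 0 d :: 'a set))"
    using has_bochner_integral_mult_right[OF has_bochner_integral_add[OF I[of x] I[of y]], of "C * (L * norm (x - y))"]
    by (simp add: has_bochner_integral_iff)
  finally show "(\<integral>q. \<bar>v q * (\<eta> (q - x) - \<eta> (q - y))\<bar> \<partial>lborel) \<le> 2 * C * L * measure lborel (cball 0 d :: 'a set) * norm (x - y)"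
    by (simp add: algebra_simps)
qed

lemma integrable_difference: "integrable lborel (\<lambda>q. v q * (\<eta> (q - x) - \<eta> (q - y)))"
  using Bochner_Integration.integrable_diff[OF integrable_v_\<eta> integrable_v_\<eta>] by (simp add: right_diff_distrib)

lemma moll_diff: "moll x - moll y = (\<integral>q. v q * (\<eta> (q - x) - \<eta> (q - y)) \<partial>lborel)"
  unfolding moll_def
  by (simp add: Bochner_Integration.integral_diff[OF integrable_v_\<eta> integrable_v_\<eta>, symmetric] right_diff_distrib)

lemma moll_bound: "\<bar>moll x\<bar> \<le> C"
proof -
  have "\<bar>moll x\<bar> \<le> (\<integral>q. \<bar>v q * \<eta> (q - x)\<bar> \<partial>lborel)"
    unfolding moll_def using integral_norm_bound[of lborel "\<lambda>q. v q * \<eta> (q - x)"] by simp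
  also have "\<dots> \<le> (\<integral>q. C * \<eta> (q - x) \<partial>lborel)"
    using integrable_v_\<eta> \<eta>_translate v_bound \<eta>_nonneg
    by (intro integral_mono integrable_abs integrable_mult_right)
      (auto intro: integrable.intros simp: abs_mult mult_right_mono)
  also have "\<dots> = C"
    using has_bochner_integral_mult_right[OF \<eta>_translate[of x], of C] by (simp add: has_bochner_integral_iff)
  finally show ?thesis .
qed

lemma continuous_moll: "continuous_on UNIV moll"
proof -
  let ?M = "2 * C * L * measure lborel (cball 0 d :: 'a set)"
  have "?M-lipschitz_on UNIV moll"
  proof (rule lipschitz_onI)
    fix x y
    have "\<bar>moll x - moll y\<bar> \<le> (\<integral>q. \<bar>v q * (\<eta> (q - x) - \<eta> (q - y))\<bar> \<partial>lborel)"
      unfolding moll_diff using integral_norm_bound[of lborel "\<lambda>q. v q * (\<eta> (q - x) - \<eta> (q - y))"] by simp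
    also note integral_difference_le(2)
    finally show "dist (moll x) (moll y) \<le> ?M * dist x y"
      by (simp add: dist_norm)
  qed (use C_nonneg L_nonneg in simp)
  then show ?thesis by (rule lipschitz_on_continuous_on)
qed

text \<open>A mollification is an average with unit mass over a ball of radius d. The hypothesis
  holds only almost everywhere because v agrees with the original function only up to a null
  set.\<close>

lemma moll_approx:
  assumes "AE q in lborel. dist q x < d \<longrightarrow> \<bar>v q - c\<bar> \<le> e"
  shows "\<bar>moll x - c\<bar> \<le> e"
proof -
  have i: "has_bochner_integral lborel (\<lambda>q. v q * \<eta> (q - x) - c * \<eta> (q - x)) (moll x - c * 1)"
    unfolding moll_def
    by (intro has_bochner_integral_diff has_bochner_integral_integrable integrable_v_\<eta> has_bochner_integral_mult_right \<eta>_translate)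
  then have "\<bar>moll x - c\<bar> \<le> (\<integral>q. \<bar>v q * \<eta> (q - x) - c * \<eta> (q - x)\<bar> \<partial>lborel)"
    using integral_norm_bound[of lborel "\<lambda>q. v q * \<eta> (q - x) - c * \<eta> (q - x)"] by (simp add: has_bochner_integral_iff)
  also have "\<dots> \<le> (\<integral>q. e * \<eta> (q - x) \<partial>lborel)"
  proof (rule integral_mono_AE)
    show "integrable lborel (\<lambda>q. \<bar>v q * \<eta> (q - x) - c * \<eta> (q - x)\<bar>)"
      using i by (intro integrable_abs) (rule integrable.intros)
    show "integrable lborel (\<lambda>q. e * \<eta> (q - x))"
      using \<eta>_translate by (auto intro: integrable.intros)
    show "AE q in lborel. \<bar>v q * \<eta> (q - x) - c * \<eta> (q - x)\<bar> \<le> e * \<eta> (q - x)"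
      using assms
    proof eventually_elim
      case (elim q)
      have "\<bar>v q * \<eta> (q - x) - c * \<eta> (q - x)\<bar> = \<bar>v q - c\<bar> * \<eta> (q - x)"
        using \<eta>_nonneg by (simp add: left_diff_distrib[symmetric] abs_mult)
      then show ?case
        using elim \<eta>_nonneg[of "q - x"] \<eta>_support[of "q - x"]
        by (cases "dist q x < d") (auto simp: dist_norm mult_right_mono)
    qed
  qed
  also have "\<dots> = e"
    using has_bochner_integral_mult_right[OF \<eta>_translate[of x], of e] by (simp add: has_bochner_integral_iff)
  finally show ?thesis .
qed

text \<open>Fubini moves the nonlocal operator from the mollification onto the bump, so the equation
  for \<open>moll\<close> at x becomes the weak equation for v tested with the bump centred at
  x.\<close>

lemma has_bochner_integral_moll_kernel:
  assumes s: "0 < s" "s < 1 / 2"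
  shows "has_bochner_integral lborel (\<lambda>z. (moll x - moll (x + z)) * frac_kernel s z)
    (\<integral>q. v q * (\<integral>z. (\<eta> (q - x) - \<eta> (q - x - z)) * frac_kernel s z \<partial>lborel) \<partial>lborel)"
proof -
  define G where "G z q = v q * (\<eta> (q - x) - \<eta> (q - (x + z))) * frac_kernel s z" for z q
  have G[measurable]: "case_prod G \<in> borel_measurable (lborel \<Otimes>\<^sub>M lborel)"
    unfolding G_def by measurable
  have "integrable (lborel \<Otimes>\<^sub>M lborel) (case_prod G)"
  proof (rule lborel_pair.Fubini_integrable[OF G])
    have "integrable lborel (\<lambda>z. (\<integral>q. \<bar>v q * (\<eta> (q - x) - \<eta> (q - (x + z)))\<bar> \<partial>lborel) * frac_kernel s z)"
    proof (rule integrable_mult_frac_kernel[OF s])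
      fix z
      show "\<bar>\<integral>q. \<bar>v q * (\<eta> (q - x) - \<eta> (q - (x + z)))\<bar> \<partial>lborel\<bar> \<le> 2 * C"
        using integral_difference_le(1)[of x "x + z"] by simp
      show "\<bar>\<integral>q. \<bar>v q * (\<eta> (q - x) - \<eta> (q - (x + z)))\<bar> \<partial>lborel\<bar>
          \<le> 2 * C * L * measure lborel (cball 0 d :: 'a set) * norm z"
        using integral_difference_le(2)[of x "x + z"] by simp
    qed measurable
    then show "integrable lborel (\<lambda>z. \<integral>q. norm (case_prod G (z, q)) \<partial>lborel)"
      by (simp add: G_def abs_mult)
    show "AE z in lborel. integrable lborel (\<lambda>q. case_prod G (z, q))"
      using integrable_difference by (auto simp: G_def)
  qed
  note iG = this
  have G1: "(\<integral>q. G z q \<partial>lborel) = (moll x - moll (x + z)) * frac_kernel s z" for z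
    unfolding G_def moll_diff by simp
  have G2: "(\<integral>z. G z q \<partial>lborel) = v q * (\<integral>z. (\<eta> (q - x) - \<eta> (q - x - z)) * frac_kernel s z \<partial>lborel)" for q
    unfolding G_def by (simp add: mult.assoc diff_diff_eq)
  show ?thesis
    using lborel_pair.integrable_fst'[OF iG] lborel_pair.Fubini_integral[OF iG]
    by (simp add: has_bochner_integral_iff G1 G2)
qed

end

section \<open>Convergence to constants\<close>

lemma frac_const_pos:
  assumes "0 < s" "s < 1"
  shows "frac_const N s > 0"
  unfolding frac_const_def using assms
  by (intro mult_pos_pos divide_pos_pos Gamma_real_pos) (auto intro: add_nonneg_pos)

text \<open>A cube bump divided by its integral I. The half-side \<delta>/N places the cube inside
  the ball of radius \<delta>.\<close>

lemma exists_mollifier: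
  assumes "\<delta> > 0"
  obtains \<eta> :: "'a::euclidean_space \<Rightarrow> real" and A L where
    "\<And>x. bump_alg (\<lambda>y. \<eta> (y - x))" "\<And>x. 0 \<le> \<eta> x" "\<And>x. \<eta> x \<le> A"
    "\<And>x y. \<bar>\<eta> x - \<eta> y\<bar> \<le> L * norm (x - y)" "\<And>x. norm x \<ge> \<delta> \<Longrightarrow> \<eta> x = 0"
    "has_bochner_integral lborel \<eta> 1"
proof -
  define d where "d = \<delta> / DIM('a)"
  have d: "d > 0" "d * DIM('a) = \<delta>" using assms by (simp_all add: d_def)
  let ?b = "cube_bump d :: 'a \<Rightarrow> real"
  define I where "I = integral\<^sup>L lborel ?b"
  have cont: "continuous_on UNIV ?b"
    using bump_alg_continuous[OF cube_bump_translate_alg[of 1 d 0]] by simp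
  then have [measurable]: "?b \<in> borel_measurable borel"
    by (rule borel_measurable_continuous_onI)
  have int: "integrable lborel ?b"
  proof (rule Bochner_Integration.integrable_bound[where f = "indicator (cball 0 \<delta>) :: 'a \<Rightarrow> real"])
    show "integrable lborel (indicator (cball 0 \<delta>) :: 'a \<Rightarrow> real)"
      using assms by (simp add: emeasure_cball)
    show "AE x in lborel. norm (?b x) \<le> norm (indicator (cball 0 \<delta>) x :: real)"
      using cube_bump_eq_0[where 'a = 'a and d = d] cube_bump_bounds[where 'a = 'a and d = d]
      by (auto simp: d(2) indicator_def)
  qed simp
  have "I > 0"
  proof -
    \<comment> \<open>A zero integral would make the nonzero set of the bump negligible, but that
      set is open and contains the origin.\<close>
    have "I \<noteq> 0"
    proof
      assume "I = 0"
      then have "AE x in lborel. ?b x = 0"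
        using integral_nonneg_eq_0_iff_AE[OF int AE_I2] cube_bump_bounds(1) by (auto simp: I_def)
      then have "AE x in lebesgue. ?b x = 0" by (rule AE_completion)
      then obtain N where "negligible N" "{x. ?b x \<noteq> 0} \<subseteq> N"
        by (auto simp: eventually_ae_filter_negligible)
      then have "negligible {x. ?b x \<noteq> 0}" by (rule negligible_subset)
      moreover have "open {x. ?b x \<noteq> 0}"
        using cont by (intro open_Collect_neq) (auto intro: continuous_intros)
      moreover have "0 \<in> {x. ?b x \<noteq> 0}" using cube_bump_0_pos[OF d(1), where 'a = 'a] by simp
      ultimately show False using open_not_negligible by blast
    qed
    moreover have "I \<ge> 0" unfolding I_def by (intro Bochner_Integration.integral_nonneg cube_bump_bounds)
    ultimately show ?thesis by simp
  qed
  show ?thesis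
  proof (rule that[of "\<lambda>x. 1 / I * ?b x" "1 / I" "1 / I * (4 * DIM('a))"])
    show "bump_alg (\<lambda>y. 1 / I * ?b (y - x))" for x
      by (rule cube_bump_translate_alg)
    show "0 \<le> 1 / I * ?b x" "1 / I * ?b x \<le> 1 / I" for x
      using \<open>I > 0\<close> cube_bump_bounds[of d x] by (auto simp: divide_right_mono)
    show "\<bar>1 / I * ?b x - 1 / I * ?b y\<bar> \<le> 1 / I * (4 * DIM('a)) * norm (x - y)" for x y
      unfolding right_diff_distrib[symmetric] abs_mult mult.assoc
      using \<open>I > 0\<close> cube_bump_lipschitz[of d x y] by (intro mult_mono) auto
    show "1 / I * ?b x = 0" if "norm x \<ge> \<delta>" for x
      using that cube_bump_eq_0[of d x] by (simp add: d(2))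
    have "has_bochner_integral lborel (\<lambda>x. 1 / I * ?b x) (1 / I * I)"
      unfolding I_def by (intro has_bochner_integral_mult_right has_bochner_integral_integrable int)
    then show "has_bochner_integral lborel (\<lambda>x. 1 / I * ?b x) 1"
      using \<open>I > 0\<close> by simp
  qed
qed

text \<open>The bound for mollifications passes to u as the scale shrinks: continuity gives
  convergence at x0 and y0, and Q does not depend on the scale. The radius 2r leaves room r for the
  centres x and r for the supports of the bumps.\<close>

lemma s_harmonic_oscillation_bound:
  fixes C r D :: real
  assumes C: "C > 0" and r: "r > 0" and D: "D \<ge> 0"
  obtains Q where "Q \<ge> 0"
    "\<And>s (u :: 'a::euclidean_space \<Rightarrow> real) \<Omega> x0 y0.
       \<lbrakk>0 < s; s \<le> 1 / 4; u \<in> borel_measurable lebesgue; AE x in lebesgue. \<bar>u x\<bar> \<le> C;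
        s_harmonic s u \<Omega>; continuous_on \<Omega> u; cball x0 (2 * r) \<subseteq> \<Omega>; cball y0 (2 * r) \<subseteq> \<Omega>; norm (x0 - y0) \<le> D\<rbrakk>
        \<Longrightarrow> u x0 - u y0 \<le> Q * s"
proof -
  obtain Q where Q: "Q \<ge> 0"
    "\<And>s (w :: 'a \<Rightarrow> real) x0 y0.
       \<lbrakk>0 < s; s \<le> 1 / 4; continuous_on UNIV w; \<And>x. \<bar>w x\<bar> \<le> C; norm (x0 - y0) \<le> D;
        \<And>x. norm (x - x0) < r \<or> norm (x - y0) < r \<Longrightarrow>
          has_bochner_integral lborel (\<lambda>z. (w x - w (x + z)) * frac_kernel s z) 0\<rbrakk> \<Longrightarrow> w x0 - w y0 \<le> Q * s"
    using frac_oscillation_bound[OF C r D, where 'a = 'a] by blast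
  show ?thesis
  proof (rule that[OF Q(1)])
    fix s and u :: "'a \<Rightarrow> real" and \<Omega> x0 y0
    assume s: "0 < s" "s \<le> 1 / 4" and u: "u \<in> borel_measurable lebesgue" "AE x in lebesgue. \<bar>u x\<bar> \<le> C"
      and harm: "s_harmonic s u \<Omega>" and cont: "continuous_on \<Omega> u"
      and ball: "cball x0 (2 * r) \<subseteq> \<Omega>" "cball y0 (2 * r) \<subseteq> \<Omega>" and xy: "norm (x0 - y0) \<le> D"
    obtain u' where u': "u' \<in> borel_measurable lborel" "AE x in lborel. u x = u' x"
      using completion_ex_borel_measurable_real[OF u(1)] by blast
    \<comment> \<open>Truncating a Borel version makes the almost-everywhere bound hold at every
      point.\<close>
    define v where "v x = max (- C) (min C (u' x))" for x
    have [measurable]: "v \<in> borel_measurable borel"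
      using u'(1) unfolding v_def by simp
    have v: "\<bar>v x\<bar> \<le> C" for x using C by (auto simp: v_def)
    have "AE x in lebesgue. u x = u' x"
      using u'(2) by (rule AE_completion)
    then have uv: "AE x in lebesgue. v x = u x"
      using u(2) by eventually_elim (auto simp: v_def)
    have uv': "AE x in lborel. v x = u x"
      using uv by (simp add: AE_completion_iff)
    show "u x0 - u y0 \<le> Q * s"
    proof (rule field_le_epsilon)
      fix e :: real assume "e > 0"
      define e' where "e' = e / 2"
      have e': "e' > 0" using \<open>e > 0\<close> by (simp add: e'_def)
      have near: "\<exists>\<delta>>0. \<forall>q. dist q x < \<delta> \<longrightarrow> \<bar>u q - u x\<bar> < e'" if "cball x (2 * r) \<subseteq> \<Omega>" for x
      proof -
        have "continuous_on (ball x (2 * r)) u"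
          using that by (intro continuous_on_subset[OF cont]) auto
        then have "isCont u x"
          using r by (simp add: continuous_on_eq_continuous_at)
        then show ?thesis
          using e' unfolding continuous_at_eps_delta by (simp add: dist_norm)
      qed
      obtain \<delta>1 \<delta>2 where \<delta>12: "\<delta>1 > 0" "\<And>q. dist q x0 < \<delta>1 \<Longrightarrow> \<bar>u q - u x0\<bar> < e'"
        "\<delta>2 > 0" "\<And>q. dist q y0 < \<delta>2 \<Longrightarrow> \<bar>u q - u y0\<bar> < e'"
        using near[OF ball(1)] near[OF ball(2)] by blast
      \<comment> \<open>The bound r keeps the test functions supported in \<Omega>; the other two
        make u vary by less than e/2 around x0 and y0.\<close>
      define \<delta> where "\<delta> = min r (min \<delta>1 \<delta>2)"
      have \<delta>: "\<delta> > 0" "\<delta> \<le> r" "\<delta> \<le> \<delta>1" "\<delta> \<le> \<delta>2" using \<delta>12 r by (auto simp: \<delta>_def)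
      obtain \<eta> :: "'a \<Rightarrow> real" and A L where \<eta>:
        "\<And>x. bump_alg (\<lambda>y. \<eta> (y - x))" "\<And>x. 0 \<le> \<eta> x" "\<And>x. \<eta> x \<le> A"
        "\<And>x y. \<bar>\<eta> x - \<eta> y\<bar> \<le> L * norm (x - y)" "\<And>x. norm x \<ge> \<delta> \<Longrightarrow> \<eta> x = 0"
        "has_bochner_integral lborel \<eta> 1"
        using exists_mollifier[OF \<delta>(1), where 'a = 'a] by metis
      have "continuous_on UNIV \<eta>" using bump_alg_continuous[OF \<eta>(1)[of 0]] by simp
      then have [measurable]: "\<eta> \<in> borel_measurable borel" by (rule borel_measurable_continuous_onI)
      interpret mollification v \<eta> C L \<delta>
        by unfold_locales (use v \<eta> \<delta> in auto)
      have "moll x0 - moll y0 \<le> Q * s"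
      proof (rule Q(2)[OF s continuous_moll moll_bound xy])
        fix x assume x: "norm (x - x0) < r \<or> norm (x - y0) < r"
        let ?\<phi> = "\<lambda>y. \<eta> (y - x)"
        define P where "P q = (\<integral>z. (\<eta> (q - x) - \<eta> (q - x - z)) * frac_kernel s z \<partial>lborel)" for q
        have [measurable]: "P \<in> borel_measurable borel"
          unfolding P_def by measurable
        have "frac_lap s ?\<phi> q = frac_const DIM('a) s * P q" for q
        proof -
          have "frac_lap s ?\<phi> q = frac_const DIM('a) s * (\<integral>z. (?\<phi> q - ?\<phi> (q - z)) * frac_kernel s z \<partial>lborel)"
          proof (rule frac_lap_eq_integral)
            show "\<bar>?\<phi> z\<bar> \<le> A" for z using \<eta>(2)[of "z - x"] \<eta>(3)[of "z - x"] by simp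
            show "\<bar>?\<phi> y - ?\<phi> z\<bar> \<le> L * norm (y - z)" for y z using \<eta>(4)[of "y - x" "z - x"] by simp
          qed (use s in auto)
          then show ?thesis by (simp add: P_def algebra_simps)
        qed
        moreover have "test_fun \<Omega> ?\<phi>"
        proof -
          have "{y. ?\<phi> y \<noteq> 0} \<subseteq> cball x \<delta>"
            using \<eta>(5) by (force simp: dist_norm norm_minus_commute)
          then have cl: "closure {y. ?\<phi> y \<noteq> 0} \<subseteq> cball x \<delta>"
            by (rule closure_minimal) simp
          have "cball x \<delta> \<subseteq> \<Omega>"
          proof -
            obtain p where p: "dist x p < r" "cball p (2 * r) \<subseteq> \<Omega>"
              using x ball by (auto simp: dist_norm)
            have "cball x \<delta> \<subseteq> cball p (2 * r)"
              using p(1) \<delta>(2) by (simp add: cball_subset_cball_iff)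
            then show ?thesis using p(2) by blast
          qed
          moreover have "compact (closure {y. ?\<phi> y \<noteq> 0})"
            using cl bounded_subset[OF bounded_cball] by (auto simp: compact_eq_bounded_closed)
          ultimately show ?thesis
            using cl bump_alg_smooth[OF \<eta>(1)] by (auto simp: test_fun_def)
        qed
        ultimately have "(\<integral>q. u q * (frac_const DIM('a) s * P q) \<partial>lebesgue) = 0"
          using harm by (auto simp: s_harmonic_def)
        \<comment> \<open>The weak equation concerns u and the completed measure. Replacing u by v
          almost everywhere makes the integrand Borel, after which the positive constant can be
          cancelled.\<close>
        also have "(\<integral>q. u q * (frac_const DIM('a) s * P q) \<partial>lebesgue) = (\<integral>q. v q * (frac_const DIM('a) s * P q) \<partial>lebesgue)"
        proof (rule integral_cong_AE)
          show "AE q in lebesgue. u q * (frac_const DIM('a) s * P q) = v q * (frac_const DIM('a) s * P q)"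
            using uv by eventually_elim simp
          have [measurable]: "P \<in> borel_measurable lebesgue" "v \<in> borel_measurable lebesgue"
            by (auto intro: measurable_completion)
          note u(1)[measurable]
          show "(\<lambda>q. u q * (frac_const DIM('a) s * P q)) \<in> borel_measurable lebesgue"
            "(\<lambda>q. v q * (frac_const DIM('a) s * P q)) \<in> borel_measurable lebesgue"
            by measurable
        qed
        also have "\<dots> = (\<integral>q. v q * (frac_const DIM('a) s * P q) \<partial>lborel)"
          by (rule integral_completion) measurable
        also have "\<dots> = frac_const DIM('a) s * (\<integral>q. v q * P q \<partial>lborel)"
          by (subst integral_mult_right_zero[symmetric], rule Bochner_Integration.integral_cong) simp_all
        finally have "(\<integral>q. v q * P q \<partial>lborel) = 0"
          using frac_const_pos[of s "DIM('a)"] s by simp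
        then show "has_bochner_integral lborel (\<lambda>z. (moll x - moll (x + z)) * frac_kernel s z) 0"
          using has_bochner_integral_moll_kernel[of s x] s by (simp add: P_def)
      qed
      moreover have "\<bar>moll x0 - u x0\<bar> \<le> e'"
      proof (rule moll_approx)
        show "AE q in lborel. dist q x0 < \<delta> \<longrightarrow> \<bar>v q - u x0\<bar> \<le> e'"
          using uv' by eventually_elim (use \<delta>12(2) \<delta>(3) in \<open>auto intro: less_imp_le\<close>)
      qed
      moreover have "\<bar>moll y0 - u y0\<bar> \<le> e'"
      proof (rule moll_approx)
        show "AE q in lborel. dist q y0 < \<delta> \<longrightarrow> \<bar>v q - u y0\<bar> \<le> e'"
          using uv' by eventually_elim (use \<delta>12(4) \<delta>(4) in \<open>auto intro: less_imp_le\<close>)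
      qed
      ultimately show "u x0 - u y0 \<le> Q * s + e"
        unfolding e'_def by linarith
    qed
  qed
qed

text \<open>The weak equation determines \<open>u s\<close> only up to null sets; continuity on
  \<Omega> fixes the representative whose supremum over K is meant. The argument yields a linear
  rate: the infimum is at most Q s for all small s.\<close>

theorem theorem1p1:
  fixes u :: "real \<Rightarrow> 'a::euclidean_space \<Rightarrow> real"
    and \<Omega> :: "'a set" and s0 C :: real
  assumes "DIM('a) \<ge> 2"
    and "0 < s0" "s0 < 1"
    and "open \<Omega>" "connected \<Omega>" "bounded \<Omega>"
    and "C > 0"
    and "\<And>s. s \<in> {0<..s0} \<Longrightarrow> u s \<in> borel_measurable lebesgue"
    and "\<And>s. s \<in> {0<..s0} \<Longrightarrow> AE x in lebesgue. \<bar>u s x\<bar> \<le> C"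
    and "\<And>s. s \<in> {0<..s0} \<Longrightarrow> s_harmonic s (u s) \<Omega>"
    and "\<And>s. s \<in> {0<..s0} \<Longrightarrow> continuous_on \<Omega> (u s)"
  shows "\<forall>K. compact K \<and> K \<noteq> {} \<and> K \<subseteq> \<Omega> \<longrightarrow>
           ((\<lambda>s. INF c. SUP x\<in>K. \<bar>u s x - c\<bar>) \<longlongrightarrow> 0) (at_right 0)"
proof (intro allI impI)
  fix K assume K: "compact K \<and> K \<noteq> {} \<and> K \<subseteq> \<Omega>"
  \<comment> \<open>A uniform collar around K supplies the balls of radius 2r with r = e/2, and the
    diameter of K serves as D.\<close>
  obtain e where e: "e > 0" "(\<Union>x\<in>K. cball x e) \<subseteq> \<Omega>"
    using compact_subset_open_imp_cball_epsilon_subset[of K \<Omega>] K assms(4) by auto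
  have "diameter K \<ge> 0"
    using K by (simp add: diameter_ge_0 compact_imp_bounded)
  with e(1) assms(7) obtain Q where Q: "Q \<ge> 0"
    "\<And>s (u :: 'a \<Rightarrow> real) \<Omega> x0 y0.
       \<lbrakk>0 < s; s \<le> 1 / 4; u \<in> borel_measurable lebesgue; AE x in lebesgue. \<bar>u x\<bar> \<le> C;
        s_harmonic s u \<Omega>; continuous_on \<Omega> u; cball x0 (2 * (e / 2)) \<subseteq> \<Omega>; cball y0 (2 * (e / 2)) \<subseteq> \<Omega>;
        norm (x0 - y0) \<le> diameter K\<rbrakk> \<Longrightarrow> u x0 - u y0 \<le> Q * s"
    using s_harmonic_oscillation_bound[of C "e / 2" "diameter K", where 'a = 'a] by auto
  obtain p where p: "p \<in> K" using K by blast
  have bounds: "0 \<le> (INF c. SUP x\<in>K. \<bar>u s x - c\<bar>) \<and> (INF c. SUP x\<in>K. \<bar>u s x - c\<bar>) \<le> Q * s"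
    if s: "0 < s" "s \<le> s0" "s \<le> 1 / 4" for s
  proof -
    have "s \<in> {0<..s0}" using s by simp
    note u = assms(8-11)[OF this]
    have osc: "u s x - u s y \<le> Q * s" if "x \<in> K" "y \<in> K" for x y
    proof (rule Q(2)[OF s(1) s(3) u])
      show "cball x (2 * (e / 2)) \<subseteq> \<Omega>" "cball y (2 * (e / 2)) \<subseteq> \<Omega>"
        using e(2) that by auto
      show "norm (x - y) \<le> diameter K"
        using diameter_bounded_bound[OF compact_imp_bounded that] K by (simp add: dist_norm)
    qed
    \<comment> \<open>Compactness bounds the supremum, so it dominates its value at p. The resulting
      lower bound 0, uniform in c, is also what makes the infimum well behaved.\<close>
    have nonneg: "0 \<le> (SUP x\<in>K. \<bar>u s x - c\<bar>)" for c
    proof -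
      have "compact ((\<lambda>x. \<bar>u s x - c\<bar>) ` K)"
        using K by (intro compact_continuous_image continuous_intros continuous_on_subset[OF u(4)]) auto
      then have "bdd_above ((\<lambda>x. \<bar>u s x - c\<bar>) ` K)"
        by (intro bounded_imp_bdd_above compact_imp_bounded)
      then have "\<bar>u s p - c\<bar> \<le> (SUP x\<in>K. \<bar>u s x - c\<bar>)"
        by (intro cSUP_upper p)
      then show ?thesis by linarith
    qed
    \<comment> \<open>The constant c = \<open>u s p\<close> suffices: its deviation on K is
      controlled by the oscillation in both directions.\<close>
    have "(INF c. SUP x\<in>K. \<bar>u s x - c\<bar>) \<le> (SUP x\<in>K. \<bar>u s x - u s p\<bar>)"
      using nonneg by (intro cINF_lower bdd_belowI2) auto
    also have "\<dots> \<le> Q * s"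
      using K osc[OF p] osc[OF _ p] by (intro cSUP_least) (auto simp: abs_le_iff)
    finally show ?thesis
      using nonneg by (auto intro: cINF_greatest)
  qed
  have ev: "eventually (\<lambda>s. 0 < s \<and> s \<le> s0 \<and> s \<le> 1 / 4) (at_right (0::real))"
    unfolding eventually_at_right_field using assms(2) by (intro exI[of _ "min s0 (1 / 4)"]) auto
  show "((\<lambda>s. INF c. SUP x\<in>K. \<bar>u s x - c\<bar>) \<longlongrightarrow> 0) (at_right 0)"
  proof (rule tendsto_sandwich[where f = "\<lambda>_. 0" and h = "\<lambda>s. Q * s"])
    show "((\<lambda>s. Q * s) \<longlongrightarrow> 0) (at_right 0)"
      by (auto intro!: tendsto_eq_intros)
  qed (use ev bounds in \<open>auto elim!: eventually_mono\<close>)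
qed

end
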